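(* Let $\{X_{ij}:i,j\ge1\}$ be i.i.d., non-degenerate, symmetrically distributed real random variables, let $\mathbf{Y}_n$ be the associated $n\times n$ self-normalized matrix, and let $\rho(\mathbf{Y}_n)=\max_{1\le i\le n}|\lambda_i(\mathbf{Y}_n)|$ be its spectral radius, where $\lambda_1(\mathbf{Y}_n),\dots,\lambda_n(\mathbf{Y}_n)$ are the eigenvalues of $\mathbf{Y}_n$. Then for every $\varepsilon>0$, $$\lim_{n\to\infty}\mathbb{P}\big[\rho(\mathbf{Y}_n)\ge1+\varepsilon\big]=0.$$
   Context: The self-normalized matrix is $\mathbf{Y}_n=(Y_{ij})_{1\le i,j\le n}$ with $Y_{ij}=X_{ij}/\sqrt{X_{i1}^2+\cdots+X_{in}^2}$ (a row of $\mathbf Y_n$ is set to $0$ if the corresponding row $(X_{i1},\dots,X_{in})$ vanishes). Symmetric means $X_{11}\overset{d}{=}-X_{11}$. *)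

theory Defs
  imports
    "HOL-Probability.Probability"
    "Jordan_Normal_Form.Spectral_Radius"
begin

text \<open>Rows and columns are indexed from 0, as in the matrix library. A row that vanishes is
  mapped to the zero row, because its entries are \<^term>\<open>0 / 0 = (0::real)\<close>.\<close>

definition self_normalized_mat :: "nat \<Rightarrow> (nat \<Rightarrow> nat \<Rightarrow> real) \<Rightarrow> real mat" where
  "self_normalized_mat n x =
     Matrix.mat n n (\<lambda>(i, j). x i j / sqrt (\<Sum>k<n. (x i k)\<^sup>2))"

text \<open>The eigenvalues of a real matrix are its complex ones.\<close>

definition real_spectral_radius :: "real mat \<Rightarrow> real" where
  "real_spectral_radius A = spectral_radius (map_mat complex_of_real A)"

end

(* With the signs of the entries symmetric, the monomials occurring in the coefficients of
   p(z) = det(1 - z Y) are orthogonal, and exchangeability inside a row gives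
   E prod_{i in U} Y_{i,phi(i)}^2 <= n^(-|U|); hence every coefficient of p has second moment at
   most 1, and p is bounded in probability on discs of radius R < 1.  It remains to exclude zeros.
   The traces T_k = tr Y^k are sums over closed walks: for fixed k a pair of walks whose edges have
   even multiplicities contributes O(n^(-#vertices)), with an additional factor 1/(n-1) unless every
   vertex has a single outgoing edge.  In the latter case both walks run around cycles, which leaves
   at most 2 k^2 patterns, so that limsup_n E T_k^2 <= 2 k^2.  Therefore, with
   h(z) = exp(sum_{k<=K} T_k z^k / k), the function p h is bounded in probability on the disc of
   radius R uniformly in K, while p h = 1 + O(z^(K+1)) by Newton's identities.  For large K it is
   close to 1 on smaller discs, so p has no zeros there. *)

theory Submission
  imports Defs "HOL-Complex_Analysis.Complex_Analysis"
begin

section \<open>Traces and characteristic coefficients\<close>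

text \<open>Boundedness of p alone cannot exclude zeros, and the traces cannot be expected to
  vanish: without moment assumptions a row may be dominated by a single entry, so that Y can
  resemble a signed random map, whose cycles carry eigenvalues of modulus 1. What saves the argument
  is that T_k has size at most of order k: the factor 1/k in the exponent cancels this and leaves a
  geometric series in R, so one constant L controls both p and the exponent, whatever K is. The
  product p h is studied instead of log p, because log p is available only where p has no zeros,
  which is what has to be shown. Since K is fixed before n, the wasteful factorial counts
  multiplying 1/(n-1) do no harm. Randomness is confined to two bounds by L; the complex analysis is
  deterministic.\<close>

definition words :: "nat \<Rightarrow> nat \<Rightarrow> nat list set" where
  "words n k = {xs. set xs \<subseteq> {..<n} \<and> length xs = k}"

lemma finite_words [simp]: "finite (words n k)"
  unfolding words_def by (rule finite_lists_length_eq) simp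

lemma words_0 [simp]: "words n 0 = {[]}"
  by (auto simp: words_def)

lemma sum_words_snoc:
  "(\<Sum>xs\<in>words n (Suc k). f xs) = (\<Sum>xs\<in>words n k. \<Sum>l<n. f (xs @ [l]))"
proof -
  have "words n (Suc k) = (\<lambda>(xs, l). xs @ [l]) ` (words n k \<times> {..<n})"
  proof (intro equalityI subsetI)
    fix ys assume "ys \<in> words n (Suc k)"
    then show "ys \<in> (\<lambda>(xs, l). xs @ [l]) ` (words n k \<times> {..<n})"
      by (cases ys rule: rev_cases) (auto simp: words_def)
  qed (auto simp: words_def)
  moreover have "inj_on (\<lambda>(xs, l). xs @ [l]) (words n k \<times> {..<n})"
    by (auto simp: inj_on_def)
  ultimately show ?thesis
    by (simp add: sum.reindex sum.cartesian_product case_prod_unfold o_def)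
qed

lemma sum_words_Cons:
  "(\<Sum>xs\<in>words n (Suc k). f xs) = (\<Sum>l<n. \<Sum>xs\<in>words n k. f (l # xs))"
proof -
  have "words n (Suc k) = (\<lambda>(l, xs). l # xs) ` ({..<n} \<times> words n k)"
  proof (intro equalityI subsetI)
    fix ys assume "ys \<in> words n (Suc k)"
    then show "ys \<in> (\<lambda>(l, xs). l # xs) ` ({..<n} \<times> words n k)"
      by (cases ys) (auto simp: words_def)
  qed (auto simp: words_def)
  moreover have "inj_on (\<lambda>(l, xs). l # xs) ({..<n} \<times> words n k)"
    by (auto simp: inj_on_def)
  ultimately show ?thesis
    by (simp add: sum.reindex sum.cartesian_product case_prod_unfold o_def)
qed

definition cyc_edges :: "nat list \<Rightarrow> (nat \<times> nat) list" where
  "cyc_edges xs = zip xs (rotate1 xs)"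

text \<open>A walk of \<open>Suc k\<close> steps has \<open>k\<close> interior vertices, and these
  form the word; pairing \<open>i # xs\<close> with \<open>xs @ [j]\<close> lists its edges. The
  induction splits off the last step.\<close>

lemma pow_mat_entry_walks:
  fixes A :: "'a::comm_semiring_1 mat"
  assumes A: "A \<in> carrier_mat n n" and "i < n" "j < n"
  shows "(A ^\<^sub>m Suc k) $$ (i, j) =
    (\<Sum>xs\<in>words n k. prod_list (map (($$) A) (zip (i # xs) (xs @ [j]))))"
  using \<open>j < n\<close>
proof (induction k arbitrary: j)
  case 0
  then show ?case using A by simp
next
  case (Suc k)
  have "(A ^\<^sub>m Suc (Suc k)) $$ (i, j) = (\<Sum>l<n. (A ^\<^sub>m Suc k) $$ (i, l) * A $$ (l, j))"
    using A \<open>i < n\<close> Suc.prems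
    by (simp only: pow_mat.simps(2)[of A "Suc k"])
       (simp add: scalar_prod_def lessThan_atLeast0 del: pow_mat.simps)
  also have "\<dots> = (\<Sum>l<n. \<Sum>xs\<in>words n k.
      prod_list (map (($$) A) (zip (i # xs) (xs @ [l]))) * A $$ (l, j))"
    by (intro sum.cong refl) (simp add: Suc.IH sum_distrib_right del: pow_mat.simps)
  also have "\<dots> = (\<Sum>xs\<in>words n k. \<Sum>l<n.
      prod_list (map (($$) A) (zip (i # xs @ [l]) ((xs @ [l]) @ [j]))))"
  proof (subst sum.swap, intro sum.cong refl)
    fix xs l
    have "zip (i # xs @ [l]) ((xs @ [l]) @ [j]) = zip ((i # xs) @ [l]) ((xs @ [l]) @ [j])"
      by simp
    also have "\<dots> = zip (i # xs) (xs @ [l]) @ [(l, j)]"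
      by (subst zip_append) auto
    finally show "prod_list (map (($$) A) (zip (i # xs) (xs @ [l]))) * A $$ (l, j) =
       prod_list (map (($$) A) (zip (i # xs @ [l]) ((xs @ [l]) @ [j])))"
      by simp
  qed
  finally show ?case by (simp add: sum_words_snoc)
qed

text \<open>For \<open>j = i\<close> the edge list of the previous lemma is
  \<open>cyc_edges (i # xs)\<close>, because \<open>rotate1 (i # xs) = xs @ [i]\<close>. The base
  point thus becomes the first letter of a word of length \<open>Suc k\<close>.\<close>

lemma trace_pow_closed_walks:
  fixes A :: "'a::comm_semiring_1 mat"
  assumes A: "A \<in> carrier_mat n n"
  shows "(\<Sum>i<n. (A ^\<^sub>m Suc k) $$ (i, i)) =
    (\<Sum>xs\<in>words n (Suc k). prod_list (map (($$) A) (cyc_edges xs)))"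
  by (simp add: sum_words_Cons pow_mat_entry_walks[OF A] cyc_edges_def del: pow_mat.simps)

section \<open>Eigenvalues through similarity with a triangular matrix\<close>

lemma upper_triangular_pow:
  fixes B :: "'a::comm_semiring_1 mat"
  assumes B: "B \<in> carrier_mat n n" and ut: "upper_triangular B"
  shows "i < n \<Longrightarrow> j \<le> i \<Longrightarrow> (B ^\<^sub>m k) $$ (i, j) = (if i = j then B $$ (i, i) ^ k else 0)"
proof (induction k arbitrary: i j)
  case 0
  then show ?case using B by auto
next
  case (Suc k)
  have "(B ^\<^sub>m Suc k) $$ (i, j) = (\<Sum>l<n. (B ^\<^sub>m k) $$ (i, l) * B $$ (l, j))"
    using B Suc.prems by (simp add: scalar_prod_def lessThan_atLeast0)
  also have "\<dots> = (\<Sum>l<n. if l = i then (B ^\<^sub>m k) $$ (i, i) * B $$ (i, j) else 0)"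
  proof (intro sum.cong refl)
    fix l assume l: "l \<in> {..<n}"
    consider "l < i" | "l = i" | "l > i" by linarith
    then show "(B ^\<^sub>m k) $$ (i, l) * B $$ (l, j) =
        (if l = i then (B ^\<^sub>m k) $$ (i, i) * B $$ (i, j) else 0)"
    proof cases
      case 1
      then show ?thesis using Suc.IH[of i l] Suc.prems by simp
    next
      case 3
      then have "B $$ (l, j) = 0"
        using ut B l Suc.prems by (auto simp: upper_triangular_def)
      then show ?thesis using 3 by simp
    qed simp
  qed
  also have "\<dots> = (B ^\<^sub>m k) $$ (i, i) * B $$ (i, j)"
    using Suc.prems by simp
  also have "\<dots> = (if i = j then B $$ (i, i) ^ Suc k else 0)"
    using Suc.IH[of i i] Suc.prems ut B by (auto simp: upper_triangular_def mult.commute)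
  finally show ?case .
qed

lemma trace_mult_commute:
  fixes X Y :: "'a::comm_semiring_1 mat"
  assumes "X \<in> carrier_mat n n" "Y \<in> carrier_mat n n"
  shows "(\<Sum>i<n. (X * Y) $$ (i, i)) = (\<Sum>i<n. (Y * X) $$ (i, i))"
proof -
  have "(\<Sum>i<n. (X * Y) $$ (i, i)) = (\<Sum>i<n. \<Sum>l<n. X $$ (i, l) * Y $$ (l, i))"
    using assms by (intro sum.cong refl) (simp add: scalar_prod_def lessThan_atLeast0)
  also have "\<dots> = (\<Sum>l<n. \<Sum>i<n. Y $$ (l, i) * X $$ (i, l))"
    by (subst sum.swap) (simp add: mult.commute)
  also have "\<dots> = (\<Sum>i<n. (Y * X) $$ (i, i))"
    using assms by (intro sum.cong refl) (simp add: scalar_prod_def lessThan_atLeast0)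
  finally show ?thesis .
qed

lemma prod_list_diag_mat:
  assumes "B \<in> carrier_mat n n"
  shows "(\<Prod>a\<leftarrow>diag_mat B. f a) = (\<Prod>i<n. f (B $$ (i, i)))"
  using assms by (simp add: diag_mat_def o_def prod.list_conv_set_nth lessThan_atLeast0)

text \<open>One enumeration with multiplicity, the diagonal of a Schur form, has to serve the
  determinant, all traces and the spectrum at once: Newton's identities later combine the first two,
  and the third connects them with the spectral radius.\<close>

lemma complex_mat_eigenvalue_list:
  fixes A :: "complex mat"
  assumes A: "A \<in> carrier_mat n n"
  obtains lam :: "nat \<Rightarrow> complex" where
    "\<And>z. det (1\<^sub>m n - z \<cdot>\<^sub>m A) = (\<Prod>i<n. 1 - z * lam i)"
    "\<And>k. (\<Sum>i<n. (A ^\<^sub>m k) $$ (i, i)) = (\<Sum>i<n. lam i ^ k)"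
    "spectrum A = lam ` {..<n}"
proof -
  obtain es where es: "char_poly A = (\<Prod>a\<leftarrow>es. [:- a, 1:])"
    using char_poly_factorized[OF A] by auto
  obtain B where B: "B \<in> carrier_mat n n" and ut: "upper_triangular B" and sim: "similar_mat A B"
    using schur_decomposition_exists[OF A es] by auto
  obtain P Q where wit: "similar_mat_wit A B P Q"
    using sim unfolding similar_mat_def by auto
  note w = similar_mat_witD2[OF A wit]
  define lam where "lam i = B $$ (i, i)" for i
  show ?thesis
  proof
    fix z
    have "similar_mat_wit (1\<^sub>m n - z \<cdot>\<^sub>m A) (1\<^sub>m n - z \<cdot>\<^sub>m B) P Q"
    proof (rule similar_mat_witI[of _ _ n])
      have "P * (1\<^sub>m n - z \<cdot>\<^sub>m B) * Q = (P * 1\<^sub>m n - P * (z \<cdot>\<^sub>m B)) * Q"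
        using w by (subst mult_minus_distrib_mat[of _ n n _ n]) auto
      also have "\<dots> = P * 1\<^sub>m n * Q - P * (z \<cdot>\<^sub>m B) * Q"
        using w by (subst minus_mult_distrib_mat[of _ n n _ _ n]) auto
      also have "\<dots> = 1\<^sub>m n - z \<cdot>\<^sub>m A"
        using w by (simp add: mult_smult_distrib[of _ n n _ n] mult_smult_assoc_mat[of _ n n _ n])
      finally show "1\<^sub>m n - z \<cdot>\<^sub>m A = P * (1\<^sub>m n - z \<cdot>\<^sub>m B) * Q" by simp
    qed (use w in auto)
    then have "det (1\<^sub>m n - z \<cdot>\<^sub>m A) = det (1\<^sub>m n - z \<cdot>\<^sub>m B)"
      by (intro det_similar) (auto simp: similar_mat_def)
    also have "\<dots> = prod_list (diag_mat (1\<^sub>m n - z \<cdot>\<^sub>m B))"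
      using B ut by (intro det_upper_triangular[of _ n]) (auto simp: upper_triangular_def)
    also have "\<dots> = (\<Prod>i<n. 1 - z * lam i)"
      using prod_list_diag_mat[of "1\<^sub>m n - z \<cdot>\<^sub>m B" n "\<lambda>x. x"] B
      by (simp add: lam_def minus_carrier_mat)
    finally show "det (1\<^sub>m n - z \<cdot>\<^sub>m A) = (\<Prod>i<n. 1 - z * lam i)" .
  next
    fix k
    have "(\<Sum>i<n. (A ^\<^sub>m k) $$ (i, i)) = (\<Sum>i<n. (P * (B ^\<^sub>m k * Q)) $$ (i, i))"
      unfolding similar_mat_wit_pow_id[OF wit, of k]
      using w(4-7) by (subst assoc_mult_mat[of _ n n _ n _ n]) auto
    also have "\<dots> = (\<Sum>i<n. ((B ^\<^sub>m k * Q) * P) $$ (i, i))"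
      using w by (intro trace_mult_commute) auto
    also have "(B ^\<^sub>m k * Q) * P = B ^\<^sub>m k"
      using w by (simp add: assoc_mult_mat[of _ n n _ n _ n])
    also have "(\<Sum>i<n. (B ^\<^sub>m k) $$ (i, i)) = (\<Sum>i<n. lam i ^ k)"
      by (simp add: upper_triangular_pow[OF B ut] lam_def)
    finally show "(\<Sum>i<n. (A ^\<^sub>m k) $$ (i, i)) = (\<Sum>i<n. lam i ^ k)" .
  next
    have "char_poly A = (\<Prod>a\<leftarrow>diag_mat B. [:- a, 1:])"
      using char_poly_similar[OF sim] char_poly_upper_triangular[OF B ut] by simp
    then have "char_poly A = (\<Prod>i<n. [:- lam i, 1:])"
      using prod_list_diag_mat[OF B] by (simp add: lam_def)
    then show "spectrum A = lam ` {..<n}"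
      using spectrum_root_char_poly[OF A] by (auto simp: poly_prod)
  qed
qed

text \<open>The sum of the principal minors of order \<open>k\<close>, with each minor expanded by
  the Leibniz formula. The flat index set of pairs makes the summands the signed monomials whose
  orthogonality is used.\<close>

definition minor_sum :: "nat \<Rightarrow> (nat \<Rightarrow> nat \<Rightarrow> 'a::comm_ring_1) \<Rightarrow> nat \<Rightarrow> 'a" where
  "minor_sum n a k = (\<Sum>(I, \<sigma>)\<in>(SIGMA I:{I. I \<subseteq> {..<n} \<and> card I = k}. {\<sigma>. \<sigma> permutes I}).
     of_int (sign \<sigma>) * (\<Prod>i\<in>I. a i (\<sigma> i)))"

text \<open>Multiplying out the Leibniz product amounts to choosing the set \<open>I\<close> of rows
  that contribute \<open>- z * a\<close>. Every other row contributes the identity matrix and so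
  forces a fixed point; the surviving permutations are those of \<open>I\<close>, with the same
  sign.\<close>

lemma det_one_minus_smult:
  fixes a :: "nat \<Rightarrow> nat \<Rightarrow> 'a::comm_ring_1"
  shows "det (1\<^sub>m n - z \<cdot>\<^sub>m mat n n (\<lambda>(i, j). a i j)) = (\<Sum>k\<le>n. (- z) ^ k * minor_sum n a k)"
proof -
  let ?N = "{..<n}"
  have "det (1\<^sub>m n - z \<cdot>\<^sub>m mat n n (\<lambda>(i, j). a i j)) =
      (\<Sum>p | p permutes ?N. of_int (sign p) * (\<Prod>i<n. - z * a i (p i) + (if i = p i then 1 else 0)))"
    by (subst det_def'[of _ n])
       (auto intro!: sum.cong prod.cong simp: lessThan_atLeast0 permutes_in_image algebra_simps
          dest: permutes_in_image[of _ _ i for i])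
  also have "\<dots> = (\<Sum>p | p permutes ?N. \<Sum>I\<in>Pow ?N. of_int (sign p) *
      ((\<Prod>i\<in>I. - z * a i (p i)) * (\<Prod>i\<in>?N - I. if i = p i then 1 else 0)))"
    by (subst prod_add) (auto simp: sum_distrib_left)
  also have "\<dots> = (\<Sum>I\<in>Pow ?N. \<Sum>p | p permutes ?N. of_int (sign p) *
      ((\<Prod>i\<in>I. - z * a i (p i)) * (\<Prod>i\<in>?N - I. if i = p i then 1 else 0)))"
    by (rule sum.swap)
  also have "\<dots> = (\<Sum>I\<in>Pow ?N. \<Sum>p | p permutes I. of_int (sign p) * (\<Prod>i\<in>I. - z * a i (p i)))"
  proof (rule sum.cong[OF refl])
    fix I assume I: "I \<in> Pow ?N"
    show "(\<Sum>p | p permutes ?N. of_int (sign p) *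
      ((\<Prod>i\<in>I. - z * a i (p i)) * (\<Prod>i\<in>?N - I. if i = p i then 1 else 0))) =
      (\<Sum>p | p permutes I. of_int (sign p) * (\<Prod>i\<in>I. - z * a i (p i)))"
    proof (rule sum.mono_neutral_cong_right)
      show "{p. p permutes I} \<subseteq> {p. p permutes ?N}"
        using I by (auto intro: permutes_subset)
      show "\<forall>p\<in>{p. p permutes ?N} - {p. p permutes I}. of_int (sign p) *
      ((\<Prod>i\<in>I. - z * a i (p i)) * (\<Prod>i\<in>?N - I. if i = p i then 1 else 0)) = 0"
      proof
        fix p assume p: "p \<in> {p. p permutes ?N} - {p. p permutes I}"
        then obtain i where "i \<in> ?N - I" "p i \<noteq> i"
          by (metis (mono_tags, lifting) DiffD1 DiffD2 Diff_iff mem_Collect_eq permutes_superset)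
        then have "(\<Prod>i\<in>?N - I. if i = p i then 1 else 0) = (0::'a)"
          by (intro prod_zero bexI[of _ i]) auto
        then show "of_int (sign p) *
      ((\<Prod>i\<in>I. - z * a i (p i)) * (\<Prod>i\<in>?N - I. if i = p i then 1 else 0)) = 0" by simp
      qed
      fix p assume "p \<in> {p. p permutes I}"
      then have "(\<Prod>i\<in>?N - I. if i = p i then 1 else 0) = (1::'a)"
        by (intro prod.neutral) (auto simp: permutes_not_in)
      then show "of_int (sign p) *
      ((\<Prod>i\<in>I. - z * a i (p i)) * (\<Prod>i\<in>?N - I. if i = p i then 1 else 0)) =
       of_int (sign p) * (\<Prod>i\<in>I. - z * a i (p i))" by simp
    qed (simp add: finite_permutations)
  qed
  also have "\<dots> = (\<Sum>I\<in>Pow ?N. (- z) ^ card I * (\<Sum>p | p permutes I. of_int (sign p) * (\<Prod>i\<in>I. a i (p i))))"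
    by (simp only: prod.distrib prod_constant sum_distrib_left mult_ac)
  also have "\<dots> = (\<Sum>k\<le>n. \<Sum>I | I \<in> Pow ?N \<and> card I = k. (- z) ^ card I * (\<Sum>p | p permutes I. of_int (sign p) * (\<Prod>i\<in>I. a i (p i))))"
    by (rule sum.group[symmetric]) (auto dest: card_mono[of ?N, rotated])
  also have "\<dots> = (\<Sum>k\<le>n. (- z) ^ k * minor_sum n a k)"
  proof (intro sum.cong refl)
    fix k
    have "finite {I. I \<subseteq> ?N \<and> card I = k}" by (rule finite_subset[of _ "Pow ?N"]) auto
    moreover have "\<forall>I\<in>{I. I \<subseteq> ?N \<and> card I = k}. finite {\<sigma>. \<sigma> permutes I}"
      by (auto intro!: finite_permutations finite_subset[of _ ?N])
    ultimately have "minor_sum n a k = (\<Sum>I | I \<subseteq> ?N \<and> card I = k. \<Sum>p | p permutes I. of_int (sign p) * (\<Prod>i\<in>I. a i (p i)))"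
      unfolding minor_sum_def by (subst sum.Sigma) (auto simp: case_prod_unfold)
    then show "(\<Sum>I | I \<in> Pow ?N \<and> card I = k. (- z) ^ card I * (\<Sum>p | p permutes I. of_int (sign p) * (\<Prod>i\<in>I. a i (p i)))) = (- z) ^ k * minor_sum n a k"
      by (simp add: sum_distrib_left)
  qed
  finally show ?thesis .
qed

section \<open>Counting pairs of closed walks\<close>

text \<open>Append one letter: at most \<open>m\<close> choices repeat an old letter and keep the
  weight, and at most \<open>n\<close> choices are new and divide it by \<open>n\<close>. Each step
  therefore costs a factor of at most \<open>1 + m\<close>.\<close>

lemma sum_words_inverse_power_card:
  assumes n: "n > 0"
  shows "(\<Sum>xs\<in>words n m. 1 / real n ^ card (set xs)) \<le> fact m"
proof (induction m)
  case 0
  then show ?case by simp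
next
  case (Suc m)
  have step: "(\<Sum>l<n. 1 / real n ^ card (set (xs @ [l]))) \<le> (1 + real m) * (1 / real n ^ card (set xs))"
    if xs: "xs \<in> words n m" for xs
  proof -
    let ?w = "1 / real n ^ card (set xs)"
    have sub: "set xs \<subseteq> {..<n}" and len: "length xs = m" using xs by (auto simp: words_def)
    have "(\<Sum>l<n. 1 / real n ^ card (set (xs @ [l]))) =
        (\<Sum>l<n. if l \<in> set xs then ?w else ?w / real n)"
      by (intro sum.cong refl) (simp add: insert_absorb)
    also have "\<dots> = real (card (set xs)) * ?w + real (card ({..<n} - set xs)) * (?w / real n)"
      using sub by (subst sum.If_cases) (auto simp: Int_absorb1 Diff_eq)
    also have "\<dots> \<le> real m * ?w + real n * (?w / real n)"
      using card_length[of xs] len card_mono[of "{..<n}" "{..<n} - set xs"]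
      by (intro add_mono mult_right_mono) auto
    also have "\<dots> = (1 + real m) * ?w" using n by (simp add: field_simps)
    finally show ?thesis .
  qed
  have "(\<Sum>xs\<in>words n (Suc m). 1 / real n ^ card (set xs)) \<le>
      (\<Sum>xs\<in>words n m. (1 + real m) * (1 / real n ^ card (set xs)))"
    unfolding sum_words_snoc by (intro sum_mono step)
  also have "\<dots> = (1 + real m) * (\<Sum>xs\<in>words n m. 1 / real n ^ card (set xs))"
    by (simp add: sum_distrib_left)
  also have "\<dots> \<le> (1 + real m) * fact m"
    by (intro mult_left_mono Suc.IH) auto
  finally show ?case by simp
qed

section \<open>Closed walks in which each vertex has one outgoing edge\<close>

text \<open>The closed walk is read periodically for all times, so that following it for
  \<open>m\<close> further steps needs no case distinction at the end of the list.\<close>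

definition cyc_nth :: "'a list \<Rightarrow> nat \<Rightarrow> 'a" where
  "cyc_nth xs t = xs ! (t mod length xs)"

lemma range_cyc_nth:
  assumes "xs \<noteq> []"
  shows "range (cyc_nth xs) = set xs"
proof (intro equalityI subsetI)
  fix x assume "x \<in> set xs"
  then obtain t where "t < length xs" "xs ! t = x" by (auto simp: in_set_conv_nth)
  then have "cyc_nth xs t = x" by (simp add: cyc_nth_def)
  then show "x \<in> range (cyc_nth xs)" by auto
qed (use assms in \<open>auto simp: cyc_nth_def\<close>)

lemma cyc_nth_add_length [simp]: "cyc_nth xs (t + length xs) = cyc_nth xs t"
  by (simp add: cyc_nth_def)

lemma cyc_nth_eq_nth: "t < length xs \<Longrightarrow> cyc_nth xs t = xs ! t"
  by (simp add: cyc_nth_def)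

lemma set_cyc_edges:
  assumes "xs \<noteq> []"
  shows "set (cyc_edges xs) = range (\<lambda>t. (cyc_nth xs t, cyc_nth xs (Suc t)))"
proof -
  have "set (cyc_edges xs) = (\<lambda>t. (xs ! t, xs ! (Suc t mod length xs))) ` {..<length xs}"
    unfolding cyc_edges_def set_zip by (auto simp: nth_rotate1 image_iff)
  also have "\<dots> = range (\<lambda>t. (cyc_nth xs t, cyc_nth xs (Suc t)))"
  proof (intro equalityI subsetI)
    fix e assume "e \<in> range (\<lambda>t. (cyc_nth xs t, cyc_nth xs (Suc t)))"
    then obtain t where "e = (cyc_nth xs t, cyc_nth xs (Suc t))" by auto
    then have "e = (xs ! (t mod length xs), xs ! (Suc (t mod length xs) mod length xs))"
      by (simp add: cyc_nth_def mod_Suc_eq)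
    then show "e \<in> (\<lambda>t. (xs ! t, xs ! (Suc t mod length xs))) ` {..<length xs}"
      using assms by auto
  next
    fix e assume "e \<in> (\<lambda>t. (xs ! t, xs ! (Suc t mod length xs))) ` {..<length xs}"
    then obtain t where "t < length xs" "e = (xs ! t, xs ! (Suc t mod length xs))" by auto
    then show "e \<in> range (\<lambda>t. (cyc_nth xs t, cyc_nth xs (Suc t)))"
      by (intro image_eqI[of _ _ t]) (simp_all add: cyc_nth_def)
  qed
  finally show ?thesis .
qed

lemma fst_set_cyc_edges: "fst ` set (cyc_edges xs) = set xs"
proof (cases "xs = []")
  case True
  then show ?thesis by (simp add: cyc_edges_def)
next
  case False
  then show ?thesis
    using range_cyc_nth[OF False] by (simp add: set_cyc_edges image_image)
qed

lemma set_cyc_edges_subset: "set (cyc_edges xs) \<subseteq> set xs \<times> set xs"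
  by (auto simp: cyc_edges_def dest: set_zip_leftD set_zip_rightD)

text \<open>The least return time \<open>p\<close> to \<open>F 0\<close> is a period because each
  value determines the next one. The sequence is injective before time \<open>p\<close>, hence
  \<open>p\<close> is the number of values. The return at time \<open>k\<close> makes it periodic
  from the start and not only eventually.\<close>

lemma deterministic_periodic:
  fixes F :: "nat \<Rightarrow> 'a"
  assumes k: "k > 0" and per: "\<And>t. F (t + k) = F t"
    and det: "\<And>s t. F s = F t \<Longrightarrow> F (Suc s) = F (Suc t)"
  shows "card (range F) \<le> k" "card (range F) > 0" "F t = F (t mod card (range F))"
proof -
  define p where "p = (LEAST p. p > 0 \<and> F p = F 0)"
  have ex: "k > 0 \<and> F k = F 0" using k per[of 0] by simp
  have p: "p > 0" "F p = F 0" and pk: "p \<le> k"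
    using LeastI[of "\<lambda>p. p > 0 \<and> F p = F 0", OF ex] Least_le[of "\<lambda>p. p > 0 \<and> F p = F 0", OF ex]
    by (auto simp: p_def)
  have shift: "F (s + m) = F (t + m)" if "F s = F t" for s t m
  proof (induction m)
    case (Suc m)
    then show ?case using det[of "s + m" "t + m"] by simp
  qed (simp add: that)
  have mult: "F (t + p * m) = F t" for t m
  proof (induction m)
    case (Suc m)
    have "F (t + p * Suc m) = F (0 + (t + p * m))"
      using shift[OF p(2), of "t + p * m"] by (simp add: algebra_simps)
    then show ?case using Suc by simp
  qed simp
  have mod: "F t = F (t mod p)" for t
    using mult[of "t mod p" "t div p"] by (simp only: mod_mult_div_eq)
  have inj: "inj_on F {..<p}"
  proof (rule linorder_inj_onI)
    fix s t assume st: "s < t" "s \<in> {..<p}" "t \<in> {..<p}"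
    show "F s \<noteq> F t"
    proof
      assume "F s = F t"
      \<comment> \<open>Running both sides on until the first reaches time \<open>k\<close> gives
        \<open>F 0 = F (t - s)\<close>, a return earlier than \<open>p\<close>.\<close>
      then have "F (s + (k - s)) = F (t + (k - s))" by (rule shift)
      moreover have "s + (k - s) = 0 + k" "t + (k - s) = (t - s) + k" using st pk by auto
      ultimately have "F (t - s) = F 0" by (simp only: per)
      moreover have "t - s > 0" using st by simp
      ultimately have "p \<le> t - s" unfolding p_def by (intro Least_le) auto
      then show False using st by simp
    qed
  qed auto
  have "range F = F ` {..<p}"
  proof (intro equalityI subsetI)
    fix x assume "x \<in> range F"
    then obtain t where "x = F t" by auto
    then have "x = F (t mod p)" by (subst mod[symmetric])
    then show "x \<in> F ` {..<p}" using p(1) by auto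
  qed auto
  then have "card (range F) = p" using inj by (simp add: card_image)
  then show "card (range F) \<le> k" "card (range F) > 0" "F t = F (t mod card (range F))"
    using p pk mod[of t] by simp_all
qed

text \<open>With a single outgoing edge per vertex the current vertex determines the next, so two
  walks that meet, at whatever times, move together from then on.\<close>

lemma single_valued_cyc_edgesD:
  assumes sv: "single_valued (set (cyc_edges xs) \<union> set (cyc_edges ys))"
    and "xs \<noteq> []" "ys \<noteq> []" and eq: "cyc_nth xs s = cyc_nth ys t"
  shows "cyc_nth xs (s + m) = cyc_nth ys (t + m)"
proof (induction m)
  case (Suc m)
  have "(cyc_nth xs (s + m), cyc_nth xs (s + Suc m)) \<in> set (cyc_edges xs) \<union> set (cyc_edges ys)"
    "(cyc_nth ys (t + m), cyc_nth ys (t + Suc m)) \<in> set (cyc_edges xs) \<union> set (cyc_edges ys)"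
    using assms by (auto simp: set_cyc_edges)
  then show ?case using Suc sv by (auto simp: single_valued_def)
qed (simp add: eq)

lemma single_valued_cyc_edges_period:
  assumes sv: "single_valued (set (cyc_edges xs))" and ne: "xs \<noteq> []"
  shows "cyc_nth xs t = cyc_nth xs (t mod card (set xs))"
proof -
  have "cyc_nth xs t = cyc_nth xs (t mod card (range (cyc_nth xs)))"
  proof (rule deterministic_periodic(3)[of "length xs"])
    show "cyc_nth xs (Suc s) = cyc_nth xs (Suc t)" if "cyc_nth xs s = cyc_nth xs t" for s t
      using single_valued_cyc_edgesD[of xs xs s t 1] that sv ne by simp
  qed (use ne in auto)
  then show ?thesis by (simp only: range_cyc_nth[OF ne])
qed

text \<open>Single-valuedness of the edge relation says that the walk runs, possibly several times,
  around one simple cycle of length \<open>card (set xs)\<close>.\<close>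

definition cycle_words :: "nat \<Rightarrow> nat \<Rightarrow> nat list set" where
  "cycle_words n k = {xs \<in> words n k. single_valued (set (cyc_edges xs))}"

lemma finite_cycle_words [simp]: "finite (cycle_words n k)"
  by (simp add: cycle_words_def)

lemma card_words [simp]: "card (words n k) = n ^ k"
  unfolding words_def using card_lists_length_eq[of "{..<n}" k] by simp

lemma cyc_nth_eqI:
  assumes "length xs = length ys" "\<And>t. cyc_nth xs t = cyc_nth ys t"
  shows "xs = ys"
  using assms by (intro nth_equalityI) (auto simp flip: cyc_nth_eq_nth)

text \<open>The number \<open>d\<close> of distinct vertices is a period, so the first
  \<open>d\<close> letters determine the word.\<close>

lemma card_cycle_words_le:
  assumes "k > 0"
  shows "card {xs \<in> cycle_words n k. card (set xs) = d} \<le> n ^ d"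
proof -
  have "inj_on (take d) {xs \<in> cycle_words n k. card (set xs) = d}"
  proof (rule inj_onI)
    fix xs ys
    assume x: "xs \<in> {xs \<in> cycle_words n k. card (set xs) = d}"
      and y: "ys \<in> {xs \<in> cycle_words n k. card (set xs) = d}" and eq: "take d xs = take d ys"
    have ne: "xs \<noteq> []" "ys \<noteq> []" using x y assms by (auto simp: cycle_words_def words_def)
    have len: "length xs = k" "length ys = k" using x y by (auto simp: cycle_words_def words_def)
    have d: "d > 0" "d \<le> k" using x ne card_length[of xs] by (auto simp: card_gt_0_iff len)
    show "xs = ys"
    proof (rule cyc_nth_eqI)
      fix t
      have td: "t mod d < d" using d by simp
      have "cyc_nth xs t = cyc_nth xs (t mod d)" "cyc_nth ys t = cyc_nth ys (t mod d)"
        using single_valued_cyc_edges_period[of xs t] single_valued_cyc_edges_period[of ys t] x y ne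
        by (auto simp: cycle_words_def)
      moreover have "cyc_nth xs (t mod d) = take d xs ! (t mod d)" "cyc_nth ys (t mod d) = take d ys ! (t mod d)"
        using cyc_nth_eq_nth[of "t mod d" xs] cyc_nth_eq_nth[of "t mod d" ys] less_le_trans[OF td d(2)] len td
        by auto
      ultimately show "cyc_nth xs t = cyc_nth ys t" using eq by simp
    qed (simp add: len)
  qed
  moreover have "take d ` {xs \<in> cycle_words n k. card (set xs) = d} \<subseteq> words n d"
  proof safe
    fix xs assume x: "xs \<in> cycle_words n k" "d = card (set xs)"
    then have "d \<le> length xs" using card_length[of xs] by simp
    then show "take (card (set xs)) xs \<in> words n (card (set xs))"
      using x set_take_subset[of d xs] by (auto simp: cycle_words_def words_def)
  qed
  ultimately have "card {xs \<in> cycle_words n k. card (set xs) = d} \<le> card (words n d)"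
    by (intro card_inj_on_le) auto
  then show ?thesis by simp
qed

text \<open>For each of the \<open>k\<close> possible cycle lengths \<open>d\<close>, the at most
  \<open>n ^ d\<close> words of weight \<open>1 / n ^ d\<close> contribute at most 1.\<close>

lemma sum_cycle_words_le:
  assumes k: "k > 0" and n: "n > 0"
  shows "(\<Sum>xs\<in>cycle_words n k. 1 / real n ^ card (set xs)) \<le> real k"
proof -
  have "(\<Sum>xs\<in>cycle_words n k. 1 / real n ^ card (set xs)) =
     (\<Sum>d\<in>{1..k}. \<Sum>xs | xs \<in> cycle_words n k \<and> card (set xs) = d. 1 / real n ^ card (set xs))"
  proof (rule sum.group[symmetric])
    show "(\<lambda>xs. card (set xs)) ` cycle_words n k \<subseteq> {1..k}"
      using k card_length by (fastforce simp: cycle_words_def words_def Suc_le_eq card_gt_0_iff)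
  qed auto
  also have "\<dots> = (\<Sum>d\<in>{1..k}. real (card {xs \<in> cycle_words n k. card (set xs) = d}) / real n ^ d)"
    by (intro sum.cong refl) simp
  also have "\<dots> \<le> (\<Sum>d\<in>{1..k}. 1)"
  proof (rule sum_mono)
    fix d
    have "real (card {xs \<in> cycle_words n k. card (set xs) = d}) \<le> real n ^ d"
      using card_cycle_words_le[OF k, of n d] by (metis of_nat_le_iff of_nat_power)
    then show "real (card {xs \<in> cycle_words n k. card (set xs) = d}) / real n ^ d \<le> 1"
      using n by (simp add: divide_le_eq_1)
  qed
  finally show ?thesis by simp
qed

text \<open>The condition is imposed on the union of the edges: two such walks either traverse the
  same cycle or have no vertex in common.\<close>

definition cycle_pairs :: "nat \<Rightarrow> nat \<Rightarrow> (nat list \<times> nat list) set" where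
  "cycle_pairs n k = {(xs, ys). xs \<in> words n k \<and> ys \<in> words n k \<and>
     single_valued (set (cyc_edges xs) \<union> set (cyc_edges ys))}"

lemma cycle_pairs_sym: "(xs, ys) \<in> cycle_pairs n k \<Longrightarrow> (ys, xs) \<in> cycle_pairs n k"
  by (simp add: cycle_pairs_def Un_commute)

lemma cycle_pairs_fst: "(xs, ys) \<in> cycle_pairs n k \<Longrightarrow> xs \<in> cycle_words n k"
  by (auto simp: cycle_pairs_def cycle_words_def intro: single_valued_subset)

lemma cycle_pairs_shift:
  assumes "(xs, ys) \<in> cycle_pairs n k" "k > 0" "cyc_nth xs s = cyc_nth ys t"
  shows "cyc_nth xs (s + m) = cyc_nth ys (t + m)"
  using assms by (intro single_valued_cyc_edgesD) (auto simp: cycle_pairs_def words_def)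

text \<open>A second walk that starts on the first one follows it for ever, so its starting vertex,
  one of at most \<open>k\<close>, determines it.\<close>

lemma cycle_pairs_hd_in:
  assumes k: "k > 0" and xs: "xs \<in> words n k"
  shows "card {ys. (xs, ys) \<in> cycle_pairs n k \<and> cyc_nth ys 0 \<in> set xs} \<le> k"
proof -
  have ne: "xs \<noteq> []" using xs k by (auto simp: words_def)
  have "inj_on (\<lambda>ys. cyc_nth ys 0) {ys. (xs, ys) \<in> cycle_pairs n k \<and> cyc_nth ys 0 \<in> set xs}"
  proof (rule inj_onI, safe)
    fix ys zs
    assume a: "(xs, ys) \<in> cycle_pairs n k" "(xs, zs) \<in> cycle_pairs n k" "cyc_nth ys 0 = cyc_nth zs 0"
      "cyc_nth ys 0 \<in> set xs"
    then obtain j where j: "cyc_nth xs j = cyc_nth ys 0" using range_cyc_nth[OF ne] by (metis imageE)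
    show "ys = zs"
    proof (rule cyc_nth_eqI)
      fix t show "cyc_nth ys t = cyc_nth zs t"
        using cycle_pairs_shift[OF a(1) k j, of t] cycle_pairs_shift[OF a(2) k, of j 0 t] j a(3) by simp
    qed (use a in \<open>auto simp: cycle_pairs_def words_def\<close>)
  qed
  then have "card {ys. (xs, ys) \<in> cycle_pairs n k \<and> cyc_nth ys 0 \<in> set xs} \<le> card (set xs)"
    by (rule card_inj_on_le) auto
  also have "\<dots> \<le> k" using xs card_length[of xs] by (simp add: words_def)
  finally show ?thesis .
qed

text \<open>If the walks meet when \<open>ys\<close> is at time \<open>t\<close>, follow both for
  \<open>k - t\<close> more steps: \<open>ys\<close> is then back at its start, which would lie on
  \<open>xs\<close>.\<close>

lemma cycle_pairs_disjoint:
  assumes p: "(xs, ys) \<in> cycle_pairs n k" and k: "k > 0" and hd: "cyc_nth ys 0 \<notin> set xs"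
  shows "set xs \<inter> set ys = {}"
proof (rule ccontr)
  assume "set xs \<inter> set ys \<noteq> {}"
  then obtain v where v: "v \<in> set xs" "v \<in> set ys" by auto
  have len: "length xs = k" "length ys = k" "xs \<noteq> []" "ys \<noteq> []"
    using p k by (auto simp: cycle_pairs_def words_def)
  obtain s where s: "cyc_nth xs s = v" using v(1) range_cyc_nth[of xs] len by (metis imageE)
  obtain t where t: "t < k" "cyc_nth ys t = v" using v(2) len
    by (metis cyc_nth_eq_nth in_set_conv_nth)
  have "cyc_nth xs (s + (k - t)) = cyc_nth ys (t + (k - t))"
    by (rule cycle_pairs_shift[OF p k]) (simp add: s t)
  also have "t + (k - t) = 0 + length ys" using t len by simp
  finally have "cyc_nth ys 0 = cyc_nth xs (s + (k - t))" by (simp only: cyc_nth_add_length)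
  then have "cyc_nth ys 0 \<in> set xs" using range_cyc_nth[of xs] len by auto
  then show False using hd by contradiction
qed

lemma finite_cycle_pairs [simp]: "finite (cycle_pairs n k)"
  by (rule finite_subset[of _ "words n k \<times> words n k"]) (auto simp: cycle_pairs_def)

text \<open>For fixed \<open>xs\<close>, at most \<open>k\<close> walks \<open>ys\<close> start on
  \<open>xs\<close>, each of weight at most that of \<open>xs\<close>. All others are disjoint from
  \<open>xs\<close>, so the weight factorizes and the sum over single walks gives \<open>k\<close>
  again. Summing \<open>2 * k\<close> times the weight over \<open>xs\<close> yields the last factor
  \<open>k\<close>.\<close>

lemma sum_cycle_pairs_le:
  assumes k: "k > 0" and n: "n > 0"
  shows "(\<Sum>(xs, ys)\<in>cycle_pairs n k. 1 / real n ^ card (set xs \<union> set ys)) \<le> 2 * real k ^ 2"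
proof -
  have fin: "finite {ys. (xs, ys) \<in> cycle_pairs n k \<and> P ys}" for xs P
    by (rule finite_subset[of _ "words n k"]) (auto simp: cycle_pairs_def)
  have inner: "(\<Sum>ys | (xs, ys) \<in> cycle_pairs n k. 1 / real n ^ card (set xs \<union> set ys)) \<le>
      2 * real k * (1 / real n ^ card (set xs))" if xs: "xs \<in> cycle_words n k" for xs
  proof -
    let ?w = "\<lambda>ys. 1 / real n ^ card (set xs \<union> set ys)"
    let ?A = "{ys. (xs, ys) \<in> cycle_pairs n k \<and> cyc_nth ys 0 \<in> set xs}"
    let ?B = "{ys. (xs, ys) \<in> cycle_pairs n k \<and> cyc_nth ys 0 \<notin> set xs}"
    have "(\<Sum>ys | (xs, ys) \<in> cycle_pairs n k. ?w ys) = (\<Sum>ys\<in>?A \<union> ?B. ?w ys)"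
      by (rule sum.cong) auto
    also have "\<dots> = (\<Sum>ys\<in>?A. ?w ys) + (\<Sum>ys\<in>?B. ?w ys)"
      by (rule sum.union_disjoint) (auto simp: fin)
    also have "\<dots> \<le> real k * (1 / real n ^ card (set xs)) + 1 / real n ^ card (set xs) * real k"
    proof (rule add_mono)
      have "(\<Sum>ys\<in>?A. ?w ys) \<le> (\<Sum>ys\<in>?A. 1 / real n ^ card (set xs))"
        using n by (intro sum_mono divide_left_mono power_increasing card_mono) auto
      also have "\<dots> = real (card ?A) * (1 / real n ^ card (set xs))" by simp
      also have "\<dots> \<le> real k * (1 / real n ^ card (set xs))"
        using cycle_pairs_hd_in[OF k, of xs n] xs by (intro mult_right_mono) (auto simp: cycle_words_def)
      finally show "(\<Sum>ys\<in>?A. ?w ys) \<le> real k * (1 / real n ^ card (set xs))" .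
      have "(\<Sum>ys\<in>?B. ?w ys) = (\<Sum>ys\<in>?B. 1 / real n ^ card (set xs) * (1 / real n ^ card (set ys)))"
      proof (rule sum.cong[OF refl])
        fix ys assume "ys \<in> ?B"
        then have "set xs \<inter> set ys = {}" using cycle_pairs_disjoint k by blast
        then show "?w ys = 1 / real n ^ card (set xs) * (1 / real n ^ card (set ys))"
          by (simp add: card_Un_disjoint power_add)
      qed
      also have "\<dots> = 1 / real n ^ card (set xs) * (\<Sum>ys\<in>?B. 1 / real n ^ card (set ys))"
        by (simp only: sum_distrib_left)
      also have "\<dots> \<le> 1 / real n ^ card (set xs) * (\<Sum>ys\<in>cycle_words n k. 1 / real n ^ card (set ys))"
        using cycle_pairs_fst[OF cycle_pairs_sym] by (intro mult_left_mono sum_mono2) auto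
      also have "\<dots> \<le> 1 / real n ^ card (set xs) * real k"
        by (intro mult_left_mono sum_cycle_words_le[OF k n]) simp
      finally show "(\<Sum>ys\<in>?B. ?w ys) \<le> 1 / real n ^ card (set xs) * real k" .
    qed
    finally show ?thesis by simp
  qed
  have "cycle_pairs n k = (SIGMA xs:cycle_words n k. {ys. (xs, ys) \<in> cycle_pairs n k})"
    using cycle_pairs_fst by auto
  then have "(\<Sum>(xs, ys)\<in>cycle_pairs n k. 1 / real n ^ card (set xs \<union> set ys)) =
     (\<Sum>xs\<in>cycle_words n k. \<Sum>ys | (xs, ys) \<in> cycle_pairs n k. 1 / real n ^ card (set xs \<union> set ys))"
    using fin[of _ "\<lambda>_. True"] by (subst sum.Sigma) auto
  also have "\<dots> \<le> (\<Sum>xs\<in>cycle_words n k. 2 * real k * (1 / real n ^ card (set xs)))"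
    by (intro sum_mono inner)
  also have "\<dots> = 2 * real k * (\<Sum>xs\<in>cycle_words n k. 1 / real n ^ card (set xs))"
    by (simp only: sum_distrib_left)
  also have "\<dots> \<le> 2 * real k * real k"
    by (intro mult_left_mono sum_cycle_words_le k n) auto
  finally show ?thesis by (simp add: power2_eq_square)
qed

text \<open>Concatenation embeds the pairs into the words of length \<open>2 * k\<close>. The bound
  is crude but free of \<open>n\<close>, which is enough next to the factor
  \<open>1 / (n - 1)\<close>.\<close>

lemma sum_word_pairs_le:
  assumes n: "n > 0"
  shows "(\<Sum>(xs, ys)\<in>words n k \<times> words n k. 1 / real n ^ card (set xs \<union> set ys)) \<le> fact (2 * k)"
proof -
  have "(\<Sum>(xs, ys)\<in>words n k \<times> words n k. 1 / real n ^ card (set xs \<union> set ys)) =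
     (\<Sum>zs\<in>(\<lambda>(xs, ys). xs @ ys) ` (words n k \<times> words n k). 1 / real n ^ card (set zs))"
    by (subst sum.reindex) (auto simp: inj_on_def words_def case_prod_unfold o_def)
  also have "\<dots> \<le> (\<Sum>zs\<in>words n (2 * k). 1 / real n ^ card (set zs))"
    by (intro sum_mono2 finite_words) (auto simp: words_def)
  also have "\<dots> \<le> fact (2 * k)" by (rule sum_words_inverse_power_card[OF n])
  finally show ?thesis .
qed

section \<open>Moments of the normalized rows\<close>

definition row_normalized :: "nat \<Rightarrow> (nat \<times> nat \<Rightarrow> real) \<Rightarrow> nat \<times> nat \<Rightarrow> real" where
  "row_normalized n x e = x e / sqrt (\<Sum>k<n. (x (fst e, k))\<^sup>2)"

definition flip_at :: "'a \<Rightarrow> ('a \<Rightarrow> real) \<Rightarrow> 'a \<Rightarrow> real" where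
  "flip_at e x = x(e := - x e)"

lemma row_normalized_flip_at:
  "row_normalized n (flip_at e x) e' = (if e' = e then - 1 else 1) * row_normalized n x e'"
proof -
  have "(\<Sum>k<n. (flip_at e x (fst e', k))\<^sup>2) = (\<Sum>k<n. (x (fst e', k))\<^sup>2)"
    by (intro sum.cong refl) (simp add: flip_at_def)
  then show ?thesis by (simp add: row_normalized_def flip_at_def)
qed

lemma row_normalized_swap:
  assumes "j < n" "j' < n"
  shows "row_normalized n (x \<circ> Transposition.transpose (i, j) (i, j')) e =
    row_normalized n x (Transposition.transpose (i, j) (i, j') e)"
proof -
  let ?\<tau> = "Transposition.transpose (i, j) (i, j')"
  have fst: "fst (?\<tau> e) = fst e" for e by (auto simp: Transposition.transpose_def)
  have "(\<Sum>k<n. (x (?\<tau> (a, k)))\<^sup>2) = (\<Sum>k<n. (x (a, k))\<^sup>2)" for a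
  proof (cases "a = i")
    case True
    have bij: "bij_betw (Transposition.transpose j j') {..<n} {..<n}"
      using assms by (intro bij_betw_byWitness[where f' = "Transposition.transpose j j'"]) (auto simp: Transposition.transpose_def)
    have "(\<Sum>k<n. (x (?\<tau> (a, k)))\<^sup>2) = (\<Sum>k<n. (x (a, Transposition.transpose j j' k))\<^sup>2)"
      by (intro sum.cong refl) (simp add: True Transposition.transpose_def)
    then show ?thesis
      using sum.reindex_bij_betw[OF bij, of "\<lambda>k. (x (a, k))\<^sup>2"] by simp
  qed (simp add: Transposition.transpose_def)
  then show ?thesis by (simp add: row_normalized_def fst)
qed

text \<open>The sum is the quotient of the squared row norm by itself: 1, or
  \<open>0 / 0 = 0\<close> for a vanishing row, whence an inequality.\<close>

lemma sum_row_normalized_squares_le_1: "(\<Sum>j<n. (row_normalized n x (i, j))\<^sup>2) \<le> 1"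
proof -
  let ?s = "\<Sum>k<n. (x (i, k))\<^sup>2"
  have s: "?s \<ge> 0" by (intro sum_nonneg) auto
  have "(\<Sum>j<n. (row_normalized n x (i, j))\<^sup>2) = ?s / ?s"
    using s by (simp add: row_normalized_def power_divide flip: sum_divide_distrib)
  then show ?thesis by (simp add: divide_self_if)
qed

lemma row_normalized_square_le_1:
  assumes "j < n"
  shows "(row_normalized n x (i, j))\<^sup>2 \<le> 1"
proof -
  have "(row_normalized n x (i, j))\<^sup>2 \<le> (\<Sum>j<n. (row_normalized n x (i, j))\<^sup>2)"
    using assms by (intro member_le_sum) auto
  then show ?thesis using sum_row_normalized_squares_le_1 by (rule order_trans)
qed

lemma abs_row_normalized_le_1:
  assumes "snd e < n"
  shows "\<bar>row_normalized n x e\<bar> \<le> 1"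
  using row_normalized_square_le_1[OF assms, of x "fst e"] by (simp add: abs_square_le_1)

text \<open>The dominating monomial of a walk: it depends on the set of edges only, every edge
  counting twice. As all factors are at most 1, edges may be dropped at will in upper
  bounds.\<close>

definition edges_square :: "nat \<Rightarrow> (nat \<times> nat) set \<Rightarrow> (nat \<times> nat \<Rightarrow> real) \<Rightarrow> real" where
  "edges_square n S x = (\<Prod>e\<in>S. (row_normalized n x e)\<^sup>2)"

lemma edges_square_nonneg: "0 \<le> edges_square n S x"
  by (simp add: edges_square_def prod_nonneg)

lemma edges_square_le_1:
  assumes "S \<subseteq> UNIV \<times> {..<n}"
  shows "edges_square n S x \<le> 1"
  unfolding edges_square_def using assms
  by (intro prod_le_1) (auto intro!: row_normalized_square_le_1)

lemma edges_square_antimono: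
  assumes "finite S'" "S \<subseteq> S'" "S' \<subseteq> UNIV \<times> {..<n}"
  shows "edges_square n S' x \<le> edges_square n S x"
proof -
  have "edges_square n S' x = edges_square n (S' - S) x * edges_square n S x"
    unfolding edges_square_def using assms by (intro prod.subset_diff) auto
  also have "\<dots> \<le> 1 * edges_square n S x"
    using assms by (intro mult_right_mono edges_square_le_1 edges_square_nonneg) auto
  finally show ?thesis by simp
qed

lemma prod_list_flip_at:
  "prod_list (map (row_normalized n (flip_at e x)) es) =
     (-1) ^ count_list es e * prod_list (map (row_normalized n x) es)"
  by (induction es) (auto simp: row_normalized_flip_at)

lemma prod_flip_at:
  assumes "finite S"
  shows "(\<Prod>e'\<in>S. row_normalized n (flip_at e x) e') =
     (if e \<in> S then - 1 else 1) * (\<Prod>e'\<in>S. row_normalized n x e')"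
  using assms by (induction S rule: finite_induct) (auto simp: row_normalized_flip_at)

text \<open>Entries have modulus at most 1, so each multiplicity may be lowered to 2.\<close>

lemma abs_prod_list_le_edges_square:
  assumes S: "set es \<subseteq> UNIV \<times> {..<n}" and mult: "\<And>e. e \<in> set es \<Longrightarrow> count_list es e \<ge> 2"
  shows "\<bar>prod_list (map (row_normalized n x) es)\<bar> \<le> edges_square n (set es) x"
proof -
  have "prod_list (map (row_normalized n x) es) = (\<Prod>e\<in>set es. row_normalized n x e ^ count_list es e)"
    using image_prod_mset_multiplicity[of "row_normalized n x" "mset es"]
    by (simp add: prod_mset_prod_list count_mset flip: mset_map)
  also have "\<bar>\<dots>\<bar> = (\<Prod>e\<in>set es. \<bar>row_normalized n x e\<bar> ^ count_list es e)"
    by (simp add: abs_prod power_abs)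
  also have "\<dots> \<le> (\<Prod>e\<in>set es. \<bar>row_normalized n x e\<bar> ^ 2)"
    using S by (intro prod_mono conjI power_decreasing mult abs_row_normalized_le_1) auto
  finally show ?thesis by (simp add: edges_square_def)
qed

section \<open>Moments under sign flips and exchanges of coordinates\<close>

text \<open>Sign flips of single entries and swaps of two entries are the only properties of the
  i.i.d. symmetric law that the moment bounds use. Working with the law on the coordinate space
  turns both into maps of that space.\<close>

locale symmetric_array = prob_space N for N :: "(nat \<times> nat \<Rightarrow> real) measure" +
  assumes sets_N: "sets N = sets (Pi\<^sub>M UNIV (\<lambda>_. borel))"
    and distr_flip_at: "\<And>e. distr N N (flip_at e) = N"
    and distr_swap: "\<And>e e'. distr N N (\<lambda>x. x \<circ> Transposition.transpose e e') = N"
begin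

lemma space_N [simp]: "space N = UNIV"
  using sets_eq_imp_space_eq[OF sets_N] by (simp add: space_PiM)

lemma coord_measurable [measurable]: "(\<lambda>x. x e) \<in> borel_measurable N"
  by (simp add: measurable_cong_sets[OF sets_N refl])

lemma row_normalized_measurable [measurable]: "(\<lambda>x. row_normalized n x e) \<in> borel_measurable N"
  unfolding row_normalized_def by measurable

lemma edges_square_measurable [measurable]: "edges_square n S \<in> borel_measurable N"
  unfolding edges_square_def by measurable

lemma measurable_N_I:
  assumes "\<And>e. (\<lambda>x. f x e) \<in> borel_measurable N"
  shows "f \<in> measurable N N"
  using measurable_PiM_single'[of UNIV "\<lambda>e x. f x e" N "\<lambda>_. borel"] assms
  by (simp add: measurable_cong_sets[OF refl sets_N])

lemma expectation_flip_at:
  assumes "F \<in> borel_measurable N"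
  shows "expectation (\<lambda>x. F (flip_at e x)) = expectation (F :: _ \<Rightarrow> real)"
proof -
  have "flip_at e \<in> measurable N N"
    by (rule measurable_N_I) (simp add: flip_at_def)
  from integral_distr[OF this assms] show ?thesis by (simp add: distr_flip_at)
qed

lemma expectation_swap:
  assumes "F \<in> borel_measurable N"
  shows "expectation (\<lambda>x. F (x \<circ> Transposition.transpose e e')) = expectation (F :: _ \<Rightarrow> real)"
proof -
  have "(\<lambda>x. x \<circ> Transposition.transpose e e') \<in> measurable N N"
    by (rule measurable_N_I) simp
  from integral_distr[OF this assms] show ?thesis by (simp add: distr_swap)
qed

lemma expectation_odd:
  assumes "F \<in> borel_measurable N" "\<And>x. F (flip_at e x) = - F x"
  shows "expectation F = (0 :: real)"
  using expectation_flip_at[OF assms(1), of e] by (simp add: assms(2))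

lemma integrable_bounded:
  assumes "F \<in> borel_measurable N" "\<And>x. \<bar>F x :: real\<bar> \<le> B"
  shows "integrable N F"
  by (rule integrable_const_bound[of _ B]) (use assms in auto)

lemma integrable_edges_square:
  assumes "S \<subseteq> UNIV \<times> {..<n}"
  shows "integrable N (edges_square n S)"
  by (rule integrable_bounded[of _ 1])
     (auto simp: abs_of_nonneg[OF edges_square_nonneg] edges_square_le_1[OF assms])

text \<open>Exchangeability within row \<open>i\<close> makes the edges \<open>(i, j)\<close> with \<open>j \<in> J\<close> equivalent, and the
  squares of a row sum to at most 1.\<close>

lemma expectation_edges_square_insert:
  assumes J: "J \<subseteq> {..<n}" "j \<in> J" and S: "finite S" "S \<subseteq> UNIV \<times> {..<n}"
    and disj: "\<And>j'. j' \<in> J \<Longrightarrow> (i, j') \<notin> S"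
  shows "real (card J) * expectation (edges_square n (insert (i, j) S)) \<le> expectation (edges_square n S)"
proof -
  have int: "integrable N (edges_square n (insert (i, j') S))" if "j' \<in> J" for j'
    using that J S by (intro integrable_edges_square) auto
  have eq: "expectation (edges_square n (insert (i, j') S)) = expectation (edges_square n (insert (i, j) S))"
    if j': "j' \<in> J" for j'
  proof -
    let ?\<tau> = "Transposition.transpose (i, j) (i, j')"
    have "edges_square n (insert (i, j) S) (x \<circ> ?\<tau>) = edges_square n (insert (i, j') S) x" for x
    proof -
      have "edges_square n (insert (i, j) S) (x \<circ> ?\<tau>) =
          (\<Prod>e\<in>insert (i, j) S. (row_normalized n x (?\<tau> e))\<^sup>2)"
        unfolding edges_square_def using j' J by (subst row_normalized_swap) auto
      also have "\<dots> = (row_normalized n x (i, j'))\<^sup>2 * (\<Prod>e\<in>S. (row_normalized n x (?\<tau> e))\<^sup>2)"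
        using S disj[OF J(2)] by simp
      also have "(\<Prod>e\<in>S. (row_normalized n x (?\<tau> e))\<^sup>2) = edges_square n S x"
        unfolding edges_square_def
      proof (rule prod.cong[OF refl])
        fix e assume "e \<in> S"
        then have "e \<noteq> (i, j)" "e \<noteq> (i, j')" using disj J(2) j' by auto
        then show "(row_normalized n x (?\<tau> e))\<^sup>2 = (row_normalized n x e)\<^sup>2" by simp
      qed
      also have "(row_normalized n x (i, j'))\<^sup>2 * edges_square n S x = edges_square n (insert (i, j') S) x"
        using S disj[OF j'] by (simp add: edges_square_def)
      finally show ?thesis .
    qed
    then show ?thesis
      using expectation_swap[of "edges_square n (insert (i, j) S)" "(i, j)" "(i, j')"] by simp
  qed
  have "real (card J) * expectation (edges_square n (insert (i, j) S)) =
      (\<Sum>j'\<in>J. expectation (edges_square n (insert (i, j') S)))"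
    by (simp add: eq)
  also have "\<dots> = expectation (\<lambda>x. \<Sum>j'\<in>J. edges_square n (insert (i, j') S) x)"
    using int by (intro Bochner_Integration.integral_sum[symmetric])
  also have "\<dots> \<le> expectation (edges_square n S)"
  proof (rule integral_mono)
    show "integrable N (\<lambda>x. \<Sum>j'\<in>J. edges_square n (insert (i, j') S) x)"
      using int by (intro Bochner_Integration.integrable_sum)
    show "integrable N (edges_square n S)" by (rule integrable_edges_square[OF S(2)])
    fix x
    have "(\<Sum>j'\<in>J. edges_square n (insert (i, j') S) x) =
        (\<Sum>j'\<in>J. (row_normalized n x (i, j'))\<^sup>2) * edges_square n S x"
      using S disj by (auto simp: edges_square_def sum_distrib_right intro!: sum.cong)
    also have "(\<Sum>j'\<in>J. (row_normalized n x (i, j'))\<^sup>2) \<le> (\<Sum>j'<n. (row_normalized n x (i, j'))\<^sup>2)"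
      using J by (intro sum_mono2) auto
    also have "\<dots> \<le> 1" by (rule sum_row_normalized_squares_le_1)
    finally show "(\<Sum>j'\<in>J. edges_square n (insert (i, j') S) x) \<le> edges_square n S x"
      by (simp add: mult_right_mono edges_square_nonneg)
  qed
  finally show ?thesis .
qed

text \<open>Rows are added one at a time. As row \<open>u\<close> does not occur yet, its edge may
  be exchanged with all \<open>n\<close> entries of the row, which gains a factor
  \<open>1 / n\<close>.\<close>

lemma expectation_edges_square_graph:
  assumes "finite U" "\<And>u. u \<in> U \<Longrightarrow> \<phi> u < n"
  shows "expectation (edges_square n ((\<lambda>u. (u, \<phi> u)) ` U)) \<le> 1 / real n ^ card U"
  using assms
proof (induction U rule: finite_induct)
  case empty
  then show ?case by (simp add: edges_square_def prob_space)
next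
  case (insert u U)
  let ?S = "(\<lambda>u. (u, \<phi> u)) ` U"
  have n: "real n > 0" using insert.prems[of u] by simp
  have "real (card {..<n}) * expectation (edges_square n (insert (u, \<phi> u) ?S)) \<le> expectation (edges_square n ?S)"
    using insert by (intro expectation_edges_square_insert) auto
  also have "\<dots> \<le> 1 / real n ^ card U" using insert by simp
  finally have "expectation (edges_square n (insert (u, \<phi> u) ?S)) \<le> 1 / real n ^ card U / real n"
    using n by (subst pos_le_divide_eq) (auto simp: mult.commute)
  then show ?case using insert by (simp add: mult.commute)
qed

text \<open>A second edge out of \<open>u\<close> can be exchanged only with entries other than
  \<open>(u, \<phi> u)\<close>; these are \<open>n - 1\<close>, which is the origin of the extra
  factor.\<close>

lemma expectation_edges_square_branching:
  assumes U: "finite U" "\<And>u. u \<in> U \<Longrightarrow> \<phi> u < n" and n: "n \<ge> 2"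
    and v: "u \<in> U" "v < n" "v \<noteq> \<phi> u"
  shows "expectation (edges_square n (insert (u, v) ((\<lambda>u. (u, \<phi> u)) ` U)))
     \<le> 1 / real n ^ card U / real (n - 1)"
proof -
  let ?S = "(\<lambda>u. (u, \<phi> u)) ` U"
  have "real (card ({..<n} - {\<phi> u})) * expectation (edges_square n (insert (u, v) ?S))
      \<le> expectation (edges_square n ?S)"
    using U v by (intro expectation_edges_square_insert) auto
  also have "\<dots> \<le> 1 / real n ^ card U" by (rule expectation_edges_square_graph[OF U])
  also have "card ({..<n} - {\<phi> u}) = n - 1" using U v by simp
  finally show ?thesis
    using n by (subst pos_le_divide_eq) (auto simp: mult.commute)
qed

end

section \<open>Second moments of the traces\<close>

text \<open>For \<open>k > 0\<close> this is the trace of the \<open>k\<close>-th matrix power. At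
  \<open>k = 0\<close> the empty word gives 1 and not \<open>n\<close>; the zero-free argument takes
  it at \<open>Suc k\<close> only.\<close>

definition closed_walk_sum :: "nat \<Rightarrow> (nat \<times> nat \<Rightarrow> 'a::comm_semiring_1) \<Rightarrow> nat \<Rightarrow> 'a" where
  "closed_walk_sum n a k = (\<Sum>xs\<in>words n k. prod_list (map a (cyc_edges xs)))"

context symmetric_array
begin

lemma prod_list_measurable [measurable]:
  "(\<lambda>x. prod_list (map (row_normalized n x) es)) \<in> borel_measurable N"
  by (induction es) auto

lemma closed_walk_sum_measurable [measurable]:
  "(\<lambda>x. closed_walk_sum n (row_normalized n x) k) \<in> borel_measurable N"
  unfolding closed_walk_sum_def by measurable

lemma minor_sum_measurable [measurable]:
  "(\<lambda>x. minor_sum n (\<lambda>i j. row_normalized n x (i, j)) k) \<in> borel_measurable N"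
  unfolding minor_sum_def case_prod_unfold by measurable

lemma abs_prod_list_le_1:
  assumes "set es \<subseteq> UNIV \<times> {..<n}"
  shows "\<bar>prod_list (map (row_normalized n x) es)\<bar> \<le> 1"
  using assms
proof (induction es)
  case (Cons e es)
  have "\<bar>row_normalized n x e\<bar> * \<bar>prod_list (map (row_normalized n x) es)\<bar> \<le> 1 * 1"
    using Cons by (intro mult_mono abs_row_normalized_le_1) auto
  then show ?case by (simp add: abs_mult)
qed simp

text \<open>An edge of odd multiplicity makes the product odd under a sign flip, so its mean
  vanishes. Otherwise all multiplicities are at least 2 and the product is dominated by squares over
  a subgraph: one outgoing edge per source, and one more edge if some source has two.\<close>

lemma expectation_prod_list_le:
  assumes es: "set es \<subseteq> {..<n} \<times> {..<n}" and n: "n \<ge> 2"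
  shows "\<bar>expectation (\<lambda>x. prod_list (map (row_normalized n x) es))\<bar> \<le>
     (if single_valued (set es) then 1 else 1 / real (n - 1)) * (1 / real n ^ card (fst ` set es))"
    (is "\<bar>expectation ?w\<bar> \<le> ?b")
proof (cases "\<exists>e. odd (count_list es e)")
  case True
  then obtain e where "odd (count_list es e)" by auto
  then have "expectation ?w = 0"
    by (intro expectation_odd[of _ e]) (auto simp: prod_list_flip_at)
  then show ?thesis by simp
next
  case False
  have two: "count_list es e \<ge> 2" if "e \<in> set es" for e
  proof -
    have "count_list es e \<noteq> 0" using that by (simp add: count_list_0_iff)
    moreover have "even (count_list es e)" using False by blast
    ultimately show ?thesis by presburger
  qed
  have sub: "set es \<subseteq> UNIV \<times> {..<n}" using es by auto
  have "\<bar>expectation ?w\<bar> \<le> expectation (\<lambda>x. \<bar>?w x\<bar>)" by (rule integral_abs_bound)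
  also have "\<dots> \<le> expectation (edges_square n (set es))"
  proof (rule integral_mono)
    show "integrable N (\<lambda>x. \<bar>?w x\<bar>)"
      by (rule integrable_bounded[of _ 1]) (auto intro: abs_prod_list_le_1[OF sub])
    show "integrable N (edges_square n (set es))" by (rule integrable_edges_square[OF sub])
  qed (rule abs_prod_list_le_edges_square[OF sub two])
  finally have le: "\<bar>expectation ?w\<bar> \<le> expectation (edges_square n (set es))" .
  have anti: "expectation (edges_square n (set es)) \<le> expectation (edges_square n S)" if "S \<subseteq> set es" for S
    using that sub by (intro integral_mono integrable_edges_square edges_square_antimono) auto
  \<comment> \<open>One outgoing edge is selected at every source; leaving out the remaining edges
    only enlarges the expectation.\<close>
  define \<phi> where "\<phi> u = (SOME v. (u, v) \<in> set es)" for u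
  have \<phi>: "(u, \<phi> u) \<in> set es" if "u \<in> fst ` set es" for u
    unfolding \<phi>_def using that by (metis (mono_tags, lifting) imageE prod.collapse someI)
  have \<phi>n: "\<phi> u < n" if "u \<in> fst ` set es" for u using \<phi>[OF that] es by auto
  let ?G = "(\<lambda>u. (u, \<phi> u)) ` (fst ` set es)"
  have G: "?G \<subseteq> set es" using \<phi> by auto
  show ?thesis
  proof (cases "single_valued (set es)")
    case True
    have "expectation (edges_square n ?G) \<le> 1 / real n ^ card (fst ` set es)"
      by (rule expectation_edges_square_graph) (use \<phi>n in auto)
    then show ?thesis using True le anti[OF G] by simp
  next
    case False
    then obtain u v v' where "(u, v) \<in> set es" "(u, v') \<in> set es" "v \<noteq> v'"
      by (auto simp: single_valued_def)
    \<comment> \<open>Of two distinct targets of \<open>u\<close>, at least one differs from the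
      selected \<open>\<phi> u\<close>.\<close>
    then obtain v where v: "(u, v) \<in> set es" "v \<noteq> \<phi> u" by metis
    have u: "u \<in> fst ` set es" using v(1) by force
    have vn: "v < n" using v es by auto
    have "expectation (edges_square n (insert (u, v) ?G)) \<le> 1 / real n ^ card (fst ` set es) / real (n - 1)"
      by (rule expectation_edges_square_branching) (use \<phi>n n u v vn in auto)
    moreover have "insert (u, v) ?G \<subseteq> set es" using G v by auto
    ultimately show ?thesis using False le anti[of "insert (u, v) ?G"] by (simp add: mult.commute)
  qed
qed

lemma expectation_closed_walk_sum_square:
  assumes k: "k > 0" and n: "n \<ge> 2"
  shows "expectation (\<lambda>x. (closed_walk_sum n (row_normalized n x) k)\<^sup>2) \<le>
    2 * real k ^ 2 + fact (2 * k) / real (n - 1)"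
proof -
  let ?w = "\<lambda>xs x. prod_list (map (row_normalized n x) (cyc_edges xs))"
  let ?W = "words n k \<times> words n k"
  let ?b = "\<lambda>xs ys. 1 / real n ^ card (set xs \<union> set ys)"
  have edges: "set (cyc_edges xs) \<subseteq> {..<n} \<times> {..<n}" if "xs \<in> words n k" for xs
    using set_cyc_edges_subset[of xs] that by (auto simp: words_def)
  have int: "integrable N (\<lambda>x. ?w xs x * ?w ys x)" if "xs \<in> words n k" "ys \<in> words n k" for xs ys
  proof -
    have "set (cyc_edges xs @ cyc_edges ys) \<subseteq> UNIV \<times> {..<n}"
      using edges[OF that(1)] edges[OF that(2)] by auto
    from abs_prod_list_le_1[OF this] show ?thesis
      by (intro integrable_bounded[of _ 1]) auto
  qed
  have "expectation (\<lambda>x. (closed_walk_sum n (row_normalized n x) k)\<^sup>2) =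
     expectation (\<lambda>x. \<Sum>(xs, ys)\<in>?W. ?w xs x * ?w ys x)"
    by (simp add: closed_walk_sum_def power2_eq_square sum_product sum.cartesian_product)
  also have "\<dots> = (\<Sum>(xs, ys)\<in>?W. expectation (\<lambda>x. ?w xs x * ?w ys x))"
    using int by (subst Bochner_Integration.integral_sum) (auto simp: case_prod_unfold)
  \<comment> \<open>The term with \<open>1 / (n - 1)\<close> is charged to all pairs, also to cycle
    pairs, so that the bound splits into the two sums already counted.\<close>
  also have "\<dots> \<le> (\<Sum>(xs, ys)\<in>?W. (if (xs, ys) \<in> cycle_pairs n k then ?b xs ys else 0) + ?b xs ys / real (n - 1))"
  proof (rule sum_mono, clarify)
    fix xs ys assume W: "xs \<in> words n k" "ys \<in> words n k"
    have "expectation (\<lambda>x. ?w xs x * ?w ys x) =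
        expectation (\<lambda>x. prod_list (map (row_normalized n x) (cyc_edges xs @ cyc_edges ys)))"
      by simp
    also have "\<dots> \<le> (if single_valued (set (cyc_edges xs @ cyc_edges ys)) then 1 else 1 / real (n - 1)) *
        (1 / real n ^ card (fst ` set (cyc_edges xs @ cyc_edges ys)))"
      using edges[OF W(1)] edges[OF W(2)] n
      by (intro order_trans[OF abs_ge_self expectation_prod_list_le]) auto
    also have "fst ` set (cyc_edges xs @ cyc_edges ys) = set xs \<union> set ys"
      by (simp add: image_Un fst_set_cyc_edges)
    also have "single_valued (set (cyc_edges xs @ cyc_edges ys)) \<longleftrightarrow> (xs, ys) \<in> cycle_pairs n k"
      using W by (simp add: cycle_pairs_def)
    finally show "expectation (\<lambda>x. ?w xs x * ?w ys x) \<le>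
       (if (xs, ys) \<in> cycle_pairs n k then ?b xs ys else 0) + ?b xs ys / real (n - 1)"
      by (auto simp: mult.commute split: if_splits intro: order_trans)
  qed
  also have "\<dots> = (\<Sum>p\<in>?W. if p \<in> cycle_pairs n k then ?b (fst p) (snd p) else 0) +
      (\<Sum>(xs, ys)\<in>?W. ?b xs ys) / real (n - 1)"
    by (simp add: case_prod_unfold sum.distrib sum_divide_distrib)
  also have "(\<Sum>p\<in>?W. if p \<in> cycle_pairs n k then ?b (fst p) (snd p) else 0) = (\<Sum>(xs, ys)\<in>cycle_pairs n k. ?b xs ys)"
  proof -
    have "?W \<inter> cycle_pairs n k = cycle_pairs n k" by (auto simp: cycle_pairs_def)
    then show ?thesis by (simp add: sum.If_cases case_prod_unfold)
  qed
  also have "(\<Sum>(xs, ys)\<in>cycle_pairs n k. ?b xs ys) + (\<Sum>(xs, ys)\<in>?W. ?b xs ys) / real (n - 1) \<le>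
      2 * real k ^ 2 + fact (2 * k) / real (n - 1)"
    using n k by (intro add_mono divide_right_mono sum_cycle_pairs_le sum_word_pairs_le) auto
  finally show ?thesis .
qed

lemma integrable_closed_walk_sum:
  "integrable N (\<lambda>x. closed_walk_sum n (row_normalized n x) k)"
  "integrable N (\<lambda>x. (closed_walk_sum n (row_normalized n x) k)\<^sup>2)"
proof -
  have "\<bar>closed_walk_sum n (row_normalized n x) k\<bar> \<le> (\<Sum>xs\<in>words n k. 1)" for x
    unfolding closed_walk_sum_def
  proof (rule order_trans[OF sum_abs sum_mono])
    fix xs assume "xs \<in> words n k"
    then show "\<bar>prod_list (map (row_normalized n x) (cyc_edges xs))\<bar> \<le> 1"
      using set_cyc_edges_subset[of xs] by (intro abs_prod_list_le_1) (auto simp: words_def)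
  qed
  then have b: "\<bar>closed_walk_sum n (row_normalized n x) k\<bar> \<le> real n ^ k" for x by simp
  show "integrable N (\<lambda>x. closed_walk_sum n (row_normalized n x) k)"
    by (rule integrable_bounded[OF _ b]) measurable
  have "\<bar>(closed_walk_sum n (row_normalized n x) k)\<^sup>2\<bar> \<le> (real n ^ k)\<^sup>2" for x
    using power_mono[OF b, of x 2] by simp
  then show "integrable N (\<lambda>x. (closed_walk_sum n (row_normalized n x) k)\<^sup>2)"
    by (intro integrable_bounded[of _ "(real n ^ k)\<^sup>2"]) auto
qed

text \<open>The second moment is about \<open>2 * k ^ 2\<close>, so the arithmetic-geometric mean
  inequality is applied with the balancing weight \<open>k\<close>. Linear growth in
  \<open>k\<close> is what the denominators of the exponent can absorb.\<close>

lemma expectation_abs_closed_walk_sum: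
  assumes k: "k > 0" and n: "n \<ge> 2"
  shows "expectation (\<lambda>x. \<bar>closed_walk_sum n (row_normalized n x) k\<bar>) \<le>
    2 * real k + fact (2 * k) / real (n - 1)"
proof -
  let ?T = "\<lambda>x. closed_walk_sum n (row_normalized n x) k"
  have le: "\<bar>?T x\<bar> \<le> (real k + (?T x)\<^sup>2 / real k) / 2" for x
  proof -
    have "0 \<le> (\<bar>?T x\<bar> - real k)\<^sup>2" by simp
    then have "2 * real k * \<bar>?T x\<bar> \<le> (real k)\<^sup>2 + (?T x)\<^sup>2" by (simp add: power2_diff algebra_simps)
    then show ?thesis using k by (simp add: field_simps power2_eq_square)
  qed
  have "expectation (\<lambda>x. \<bar>?T x\<bar>) \<le> expectation (\<lambda>x. (real k + (?T x)\<^sup>2 / real k) / 2)"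
    by (intro integral_mono le integrable_abs integrable_closed_walk_sum integrable_divide
        Bochner_Integration.integrable_add integrable_const)
  also have "\<dots> = (real k + expectation (\<lambda>x. (?T x)\<^sup>2) / real k) / 2"
    using integrable_closed_walk_sum prob_space by simp
  also have "\<dots> \<le> (real k + (2 * real k ^ 2 + fact (2 * k) / real (n - 1)) / real k) / 2"
    using expectation_closed_walk_sum_square[OF k n]
    by (intro divide_right_mono add_left_mono) auto
  also have "\<dots> = (3 / 2) * real k + fact (2 * k) / real (n - 1) / (2 * real k)"
    using k by (simp add: field_simps power2_eq_square)
  also have "\<dots> \<le> 2 * real k + fact (2 * k) / real (n - 1)"
    using k by (intro add_mono) (auto simp: divide_le_eq mult_ge1_I intro!: mult_right_mono)
  finally show ?thesis .
qed

section \<open>Second moments of the characteristic coefficients\<close>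

lemma abs_prod_row_normalized_le_1:
  assumes "\<And>i. i \<in> I \<Longrightarrow> \<sigma> i < n"
  shows "\<bar>\<Prod>i\<in>I. row_normalized n x (i, \<sigma> i)\<bar> \<le> 1"
  unfolding abs_prod using assms by (intro prod_le_1) (auto intro!: abs_row_normalized_le_1)

text \<open>Permutations are the identity off their set, so different pairs have different graphs.
  An entry lying in exactly one of the two graphs makes the product odd under the flip of its
  sign.\<close>

lemma expectation_minor_products:
  assumes I: "I \<subseteq> {..<n}" "\<sigma> permutes I" and J: "J \<subseteq> {..<n}" "\<tau> permutes J"
    and ne: "(I, \<sigma>) \<noteq> (J, \<tau>)"
  shows "expectation (\<lambda>x. (\<Prod>i\<in>I. row_normalized n x (i, \<sigma> i)) * (\<Prod>i\<in>J. row_normalized n x (i, \<tau> i))) = 0"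
proof -
  let ?gr = "\<lambda>\<sigma> I. (\<lambda>i. (i, \<sigma> i)) ` I"
  have fin: "finite I" "finite J" using I J finite_subset by auto
  have prod_gr: "(\<Prod>i\<in>I. row_normalized n x (i, \<sigma> i)) = (\<Prod>e\<in>?gr \<sigma> I. row_normalized n x e)" for x \<sigma> I
    by (subst prod.reindex) (auto simp: inj_on_def)
  have "?gr \<sigma> I \<noteq> ?gr \<tau> J"
  proof
    assume eq: "?gr \<sigma> I = ?gr \<tau> J"
    then have "fst ` ?gr \<sigma> I = fst ` ?gr \<tau> J" by simp
    then have IJ: "I = J" by (simp add: image_image)
    have "\<sigma> i = \<tau> i" for i
    proof (cases "i \<in> I")
      case True
      then have "(i, \<sigma> i) \<in> ?gr \<tau> J" using eq by auto
      then show ?thesis by auto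
    next
      case False
      then show ?thesis using I(2) J(2) IJ by (simp add: permutes_not_in)
    qed
    then show False using ne IJ by auto
  qed
  then obtain e where e: "(e \<in> ?gr \<sigma> I) \<noteq> (e \<in> ?gr \<tau> J)" by blast
  show ?thesis
    unfolding prod_gr
    by (rule expectation_odd[of _ e]) (use e fin in \<open>auto simp: prod_flip_at\<close>)
qed

text \<open>Orthogonality leaves the diagonal terms, each at most \<open>1 / n ^ k\<close>, and
  their number \<open>(n choose k) * k!\<close> is at most \<open>n ^ k\<close>.\<close>

lemma expectation_minor_sum_square:
  "expectation (\<lambda>x. (minor_sum n (\<lambda>i j. row_normalized n x (i, j)) k)\<^sup>2) \<le> 1"
proof -
  define \<Omega> where "\<Omega> = (SIGMA I:{I. I \<subseteq> {..<n} \<and> card I = k}. {\<sigma>. \<sigma> permutes I})"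
  define m where "m p x = of_int (sign (snd p)) * (\<Prod>i\<in>fst p. row_normalized n x (i, snd p i))" for p x
  have finI: "finite {I. I \<subseteq> {..<n} \<and> card I = k}"
    by (rule finite_subset[of _ "Pow {..<n}"]) auto
  have fin: "finite \<Omega>"
    unfolding \<Omega>_def by (intro finite_SigmaI finI) (auto intro!: finite_permutations finite_subset[of _ "{..<n}"])
  have lt: "snd p i < n" if "p \<in> \<Omega>" "i \<in> fst p" for p i
    using that permutes_in_image[of "snd p" "fst p" i] by (auto simp: \<Omega>_def)
  have mb: "\<bar>m p x\<bar> \<le> 1" if "p \<in> \<Omega>" for p x
    using abs_prod_row_normalized_le_1[of "fst p" "snd p" n x] lt[OF that]
    by (simp add: m_def abs_mult sign_def)
  have mm [measurable]: "m p \<in> borel_measurable N" for p unfolding m_def by measurable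
  have int: "integrable N (\<lambda>x. m p x * m q x)" if "p \<in> \<Omega>" "q \<in> \<Omega>" for p q
    using mult_mono[OF mb[OF that(1)] mb[OF that(2)]]
    by (intro integrable_bounded[of _ 1]) (auto simp: abs_mult)
  have off: "expectation (\<lambda>x. m p x * m q x) = 0" if "p \<in> \<Omega>" "q \<in> \<Omega>" "p \<noteq> q" for p q
  proof -
    have "expectation (\<lambda>x. m p x * m q x) = expectation (\<lambda>x. of_int (sign (snd p)) * of_int (sign (snd q)) *
       ((\<Prod>i\<in>fst p. row_normalized n x (i, snd p i)) * (\<Prod>i\<in>fst q. row_normalized n x (i, snd q i))))"
      by (simp add: m_def mult_ac)
    also have "\<dots> = of_int (sign (snd p)) * of_int (sign (snd q)) * expectation (\<lambda>x.
       (\<Prod>i\<in>fst p. row_normalized n x (i, snd p i)) * (\<Prod>i\<in>fst q. row_normalized n x (i, snd q i)))"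
      by (rule integral_mult_right_zero)
    also have "\<dots> = 0"
      using that by (subst expectation_minor_products) (auto simp: \<Omega>_def prod_eq_iff)
    finally show ?thesis .
  qed
  have diag: "expectation (\<lambda>x. m p x * m p x) \<le> 1 / real n ^ k" if "p \<in> \<Omega>" for p
  proof -
    have "m p x * m p x = edges_square n ((\<lambda>i. (i, snd p i)) ` fst p) x" for x
      unfolding m_def edges_square_def
      by (subst prod.reindex) (auto simp: inj_on_def sign_def power2_eq_square prod.distrib)
    moreover have "finite (fst p)" "card (fst p) = k"
      using that by (auto simp: \<Omega>_def intro: finite_subset[of _ "{..<n}"])
    ultimately show ?thesis
      using expectation_edges_square_graph[of "fst p" "snd p" n] lt[OF that] by simp
  qed
  have card: "card \<Omega> \<le> n ^ k"
  proof -
    have "card \<Omega> = (\<Sum>I | I \<subseteq> {..<n} \<and> card I = k. card {\<sigma>. \<sigma> permutes I})"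
      unfolding \<Omega>_def by (intro card_SigmaI finI) (auto intro!: finite_permutations finite_subset[of _ "{..<n}"])
    also have "\<dots> = (\<Sum>I | I \<subseteq> {..<n} \<and> card I = k. fact k)"
      by (intro sum.cong refl card_permutations) (auto intro: finite_subset)
    also have "\<dots> = (n choose k) * fact k"
      by (simp add: n_subsets)
    finally show ?thesis using binomial_fact_pow[of n k] by simp
  qed
  have "(minor_sum n (\<lambda>i j. row_normalized n x (i, j)) k)\<^sup>2 = (\<Sum>p\<in>\<Omega>. \<Sum>q\<in>\<Omega>. m p x * m q x)" for x
    by (simp add: minor_sum_def \<Omega>_def[symmetric] m_def case_prod_unfold power2_eq_square sum_product)
  then have "expectation (\<lambda>x. (minor_sum n (\<lambda>i j. row_normalized n x (i, j)) k)\<^sup>2) =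
     (\<Sum>p\<in>\<Omega>. \<Sum>q\<in>\<Omega>. expectation (\<lambda>x. m p x * m q x))"
    using int by (simp add: Bochner_Integration.integral_sum Bochner_Integration.integrable_sum)
  also have "\<dots> = (\<Sum>p\<in>\<Omega>. expectation (\<lambda>x. m p x * m p x))"
  proof (rule sum.cong[OF refl])
    fix p assume p: "p \<in> \<Omega>"
    have "(\<Sum>q\<in>\<Omega>. expectation (\<lambda>x. m p x * m q x)) = (\<Sum>q\<in>{p}. expectation (\<lambda>x. m p x * m q x))"
    proof (rule sum.mono_neutral_right)
      show "\<forall>q\<in>\<Omega> - {p}. expectation (\<lambda>x. m p x * m q x) = 0" using off p by blast
    qed (use p fin in auto)
    then show "(\<Sum>q\<in>\<Omega>. expectation (\<lambda>x. m p x * m q x)) = expectation (\<lambda>x. m p x * m p x)" by simp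
  qed
  also have "\<dots> \<le> (\<Sum>p\<in>\<Omega>. 1 / real n ^ k)" by (intro sum_mono diag)
  also have "\<dots> = real (card \<Omega>) / real n ^ k" by simp
  also have "\<dots> \<le> 1"
    using of_nat_mono[OF card, where 'a = real] by (auto simp: divide_le_eq_1)
  finally show ?thesis .
qed

end

section \<open>Zero-free discs\<close>

text \<open>\<open>F' = z ^ K * G\<close> with \<open>G\<close> entire, so a bound for
  \<open>F'\<close> on the circle of radius \<open>s\<close> bounds \<open>G\<close> there and, by
  the maximum principle, inside. On the disc of radius \<open>r\<close> this gains the factor
  \<open>(r / s) ^ K\<close>, while \<open>F\<close> must fall from 1 at the origin to 0 at
  \<open>z0\<close>. The conclusion is the inequality which a zero forces and which a large
  \<open>K\<close> refutes.\<close>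

lemma zero_free_disc_of_newton_exp:
  fixes lam :: "nat \<Rightarrow> complex" and e :: "nat \<Rightarrow> complex"
  assumes coeffs: "\<And>z. (\<Prod>i<n. 1 - z * lam i) = (\<Sum>k\<le>n. (- z) ^ k * e k)"
    and r: "0 \<le> r" "r < s" "s < R"
    and Le: "(\<Sum>k\<le>n. norm (e k) * R ^ k) \<le> L"
    and LT: "(\<Sum>k<K. norm (\<Sum>i<n. lam i ^ Suc k) * R ^ Suc k / real (Suc k)) \<le> L"
    and z0: "norm z0 \<le> r" "(\<Prod>i<n. 1 - z0 * lam i) = 0"
  shows "1 \<le> r * (L * exp L / (R - s)) * (r / s) ^ K"
proof -
  define p where "p z = (\<Prod>i<n. 1 - z * lam i)" for z
  define T where "T k = (\<Sum>i<n. lam i ^ k)" for k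
  define Q where "Q z = (\<Sum>k<K. T (Suc k) * z ^ Suc k / of_nat (Suc k))" for z
  define F where "F z = p z * exp (Q z)" for z
  define P where "P i z = (\<Prod>j\<in>{..<n} - {i}. 1 - z * lam j)" for i z
  define G where "G z = - exp (Q z) * (\<Sum>i<n. P i z * lam i ^ Suc K)" for z
  define C where "C = L * exp L"

  have derQ: "(Q has_field_derivative (\<Sum>k<K. T (Suc k) * z ^ k)) (at z)" for z
    unfolding Q_def
  proof (intro DERIV_sum)
    fix k
    have "((\<lambda>z. z ^ Suc k) has_field_derivative of_nat (Suc k) * z ^ k) (at z)"
      by (rule DERIV_cong, rule DERIV_power, rule DERIV_ident) simp
    from DERIV_cdivide[OF DERIV_cmult[OF this, of "T (Suc k)"], of "of_nat (Suc k)"]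
    show "((\<lambda>z. T (Suc k) * z ^ Suc k / of_nat (Suc k)) has_field_derivative T (Suc k) * z ^ k) (at z)"
      by (simp del: of_nat_Suc power_Suc)
  qed
  have derp: "(p has_field_derivative (\<Sum>i<n. - lam i * P i z)) (at z)" for z
    unfolding p_def P_def
    by (rule has_field_derivative_prod[THEN DERIV_cong]) (auto intro!: derivative_eq_intros)
  \<comment> \<open>Newton's identities in product form: \<open>p z\<close> contains the factor
    \<open>1 - z * lam i\<close>, which telescopes the geometric sum of the powers of
    \<open>z * lam i\<close>. Its constant term cancels the derivative of \<open>p\<close>, and only
    a multiple of \<open>z ^ K\<close> remains.\<close>
  have key: "(\<Sum>i<n. - lam i * P i z) + p z * (\<Sum>k<K. T (Suc k) * z ^ k) =
      - (z ^ K) * (\<Sum>i<n. P i z * lam i ^ Suc K)" for z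
  proof -
    have pP: "p z = (1 - z * lam i) * P i z" if "i < n" for i
      unfolding p_def P_def using that by (subst prod.remove[of _ i]) auto
    have "(\<Sum>k<K. T (Suc k) * z ^ k) = (\<Sum>i<n. lam i * (\<Sum>k<K. (z * lam i) ^ k))"
      unfolding T_def sum_distrib_right
      by (subst sum.swap) (simp add: sum_distrib_left power_mult_distrib mult_ac)
    then have "(\<Sum>i<n. - lam i * P i z) + p z * (\<Sum>k<K. T (Suc k) * z ^ k) =
       (\<Sum>i<n. - lam i * P i z + p z * (lam i * (\<Sum>k<K. (z * lam i) ^ k)))"
      by (simp only: sum.distrib sum_distrib_left[of "p z"])
    also have "\<dots> = (\<Sum>i<n. - (z ^ K) * (P i z * lam i ^ Suc K))"
    proof (intro sum.cong refl)
      fix i assume "i \<in> {..<n}"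
      then have "p z * (lam i * (\<Sum>k<K. (z * lam i) ^ k)) =
          P i z * lam i * ((1 - z * lam i) * (\<Sum>k<K. (z * lam i) ^ k))"
        by (simp add: pP)
      also have "(1 - z * lam i) * (\<Sum>k<K. (z * lam i) ^ k) = 1 - (z * lam i) ^ K"
        by (simp add: one_diff_power_eq)
      finally show "- lam i * P i z + p z * (lam i * (\<Sum>k<K. (z * lam i) ^ k)) =
          - (z ^ K) * (P i z * lam i ^ Suc K)"
        by (simp add: algebra_simps power_mult_distrib)
    qed
    finally show ?thesis by (simp add: sum_distrib_left)
  qed
  have derF: "(F has_field_derivative z ^ K * G z) (at z)" for z
  proof -
    have "(F has_field_derivative
      (p z * (exp (Q z) * (\<Sum>k<K. T (Suc k) * z ^ k)) + (\<Sum>i<n. - lam i * P i z) * exp (Q z))) (at z)"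
      unfolding F_def by (rule DERIV_mult' DERIV_chain2[OF DERIV_exp] derp derQ)+
    also have "(p z * (exp (Q z) * (\<Sum>k<K. T (Suc k) * z ^ k)) + (\<Sum>i<n. - lam i * P i z) * exp (Q z)) =
       exp (Q z) * ((\<Sum>i<n. - lam i * P i z) + p z * (\<Sum>k<K. T (Suc k) * z ^ k))"
      by (simp add: algebra_simps)
    also have "\<dots> = z ^ K * G z"
      unfolding key G_def by (simp add: algebra_simps)
    finally show ?thesis .
  qed
  have holQ: "Q holomorphic_on A" for A
    using derQ by (auto simp: holomorphic_on_def field_differentiable_def intro: has_field_derivative_at_within)
  have holG: "G holomorphic_on A" for A
    unfolding G_def P_def by (intro holomorphic_intros holQ)
  have holF: "F holomorphic_on A" for A
    using derF by (auto simp: holomorphic_on_def field_differentiable_def intro: has_field_derivative_at_within)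

  have R: "R > 0" "s > 0" using r by auto
  have boundF: "norm (F z) \<le> C" if z: "norm z \<le> R" for z
  proof -
    have "norm (p z) \<le> (\<Sum>k\<le>n. norm ((- z) ^ k * e k))"
      unfolding p_def coeffs by (rule norm_sum)
    also have "\<dots> \<le> (\<Sum>k\<le>n. norm (e k) * R ^ k)"
      using z by (intro sum_mono) (auto simp: norm_mult norm_power mult.commute[of _ "cmod (e _)"] intro!: mult_left_mono power_mono)
    finally have 1: "norm (p z) \<le> L" using Le by linarith
    have "norm (Q z) \<le> (\<Sum>k<K. norm (T (Suc k) * z ^ Suc k / of_nat (Suc k)))"
      unfolding Q_def by (rule norm_sum)
    also have "\<dots> \<le> (\<Sum>k<K. norm (T (Suc k)) * R ^ Suc k / real (Suc k))"
    proof (rule sum_mono)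
      fix k
      have "norm z ^ Suc k \<le> R ^ Suc k" using z by (intro power_mono) auto
      then show "norm (T (Suc k) * z ^ Suc k / of_nat (Suc k)) \<le> norm (T (Suc k)) * R ^ Suc k / real (Suc k)"
        by (simp only: norm_mult norm_divide norm_power norm_of_nat)
           (intro divide_right_mono mult_left_mono, simp_all del: power_Suc)
    qed
    finally have "norm (Q z) \<le> L" using LT unfolding T_def by linarith
    then have 2: "norm (exp (Q z)) \<le> exp L"
      using abs_Re_le_cmod[of "Q z"] by (simp add: norm_exp_eq_Re)
    show ?thesis
      unfolding F_def C_def norm_mult by (intro mult_mono 1 2 order_trans[OF norm_ge_zero 1]) auto
  qed
  have boundG: "norm (G w) \<le> C / (R - s) / s ^ K" if w: "norm w = s" for w
  proof -
    \<comment> \<open>Cauchy's estimate on the disc of radius \<open>R - s\<close> around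
      \<open>w\<close>, which stays where \<open>boundF\<close> applies.\<close>
    have "norm ((deriv ^^ 1) F w) \<le> fact 1 * C / (R - s) ^ 1"
    proof (rule Cauchy_inequality)
      show "norm (F x) \<le> C" if "norm (w - x) = R - s" for x
        using norm_triangle_ineq4[of w "w - x"] w that by (intro boundF) auto
    qed (use r holF holomorphic_on_imp_continuous_on in auto)
    then have "norm (w ^ K * G w) \<le> C / (R - s)"
      using DERIV_imp_deriv[OF derF] by simp
    then show ?thesis
      using R w by (subst pos_le_divide_eq) (auto simp: norm_mult norm_power mult.commute)
  qed
  have boundG': "norm (G w) \<le> C / (R - s) / s ^ K" if w: "norm w \<le> s" for w
  proof (rule maximum_modulus_frontier[of G "cball 0 s"])
    show "norm (G z) \<le> C / (R - s) / s ^ K" if "z \<in> frontier (cball 0 s)" for z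
      using that R by (intro boundG) (auto simp: frontier_cball)
  qed (use holG holomorphic_on_imp_continuous_on w in auto)
  have "norm (F z0 - F 0) \<le> (C / (R - s) * (r / s) ^ K) * norm (z0 - 0)"
  proof (rule field_differentiable_bound[of "cball 0 r" F "\<lambda>z. z ^ K * G z"])
    fix z :: complex assume z: "z \<in> cball 0 r"
    have "norm (z ^ K * G z) \<le> r ^ K * (C / (R - s) / s ^ K)"
      unfolding norm_mult norm_power using z r
      by (intro mult_mono power_mono boundG') auto
    then show "norm (z ^ K * G z) \<le> C / (R - s) * (r / s) ^ K"
      by (simp add: power_divide mult_ac)
  qed (use z0 r in \<open>auto intro: has_field_derivative_at_within derF\<close>)
  also have "\<dots> \<le> (C / (R - s) * (r / s) ^ K) * r"
    using z0 r boundF[of 0] R by (intro mult_left_mono) (auto intro!: mult_nonneg_nonneg divide_nonneg_nonneg intro: order_trans[OF norm_ge_zero])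
  \<comment> \<open>\<open>F z0 = 0\<close> by the choice of \<open>z0\<close>, and
    \<open>F 0 = 1\<close> since \<open>p 0 = 1\<close> and \<open>Q 0 = 0\<close>.\<close>
  also have "norm (F z0 - F 0) = 1"
    by (simp only: F_def p_def z0(2)) (simp add: Q_def)
  finally show ?thesis by (simp add: C_def mult_ac)
qed

section \<open>From zero-free discs to the spectral radius\<close>

lemma of_real_minor_sum:
  "minor_sum n (\<lambda>i j. complex_of_real (a i j)) k = of_real (minor_sum n a k)"
  by (simp add: minor_sum_def case_prod_unfold)

lemma of_real_closed_walk_sum:
  "closed_walk_sum n (\<lambda>e. complex_of_real (a e)) k = of_real (closed_walk_sum n a k)"
proof -
  have "prod_list (map (\<lambda>e. complex_of_real (a e)) es) = of_real (prod_list (map a es))" for es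
    by (induction es) auto
  then show ?thesis by (simp add: closed_walk_sum_def)
qed

text \<open>An eigenvalue of modulus at least \<open>1 / r\<close> is nonzero, and its reciprocal is
  a zero of the characteristic product in the disc of radius \<open>r\<close>, against the smallness
  assumption. \<open>n > 0\<close> guarantees that the spectral radius is attained by an
  eigenvalue.\<close>

lemma real_spectral_radius_less:
  fixes a :: "nat \<times> nat \<Rightarrow> real"
  assumes n: "n > 0" and r: "0 < r" "r < s" "s < R"
    and Le: "(\<Sum>k\<le>n. \<bar>minor_sum n (\<lambda>i j. a (i, j)) k\<bar> * R ^ k) \<le> L"
    and LT: "(\<Sum>k<K. \<bar>closed_walk_sum n a (Suc k)\<bar> * R ^ Suc k / real (Suc k)) \<le> L"
    and small: "r * (L * exp L / (R - s)) * (r / s) ^ K < 1"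
  shows "real_spectral_radius (Matrix.mat n n a) < 1 / r"
proof (rule ccontr)
  assume big: "\<not> ?thesis"
  define A where "A = Matrix.mat n n (\<lambda>(i, j). complex_of_real (a (i, j)))"
  have A: "A \<in> carrier_mat n n" by (simp add: A_def)
  have map: "map_mat complex_of_real (Matrix.mat n n a) = A"
    by (rule eq_matI) (auto simp: A_def)
  obtain lam where lam: "\<And>z. det (1\<^sub>m n - z \<cdot>\<^sub>m A) = (\<Prod>i<n. 1 - z * lam i)"
    "\<And>k. (\<Sum>i<n. (A ^\<^sub>m k) $$ (i, i)) = (\<Sum>i<n. lam i ^ k)" "spectrum A = lam ` {..<n}"
    by (rule complex_mat_eigenvalue_list[OF A]) (rule that)
  have coeffs: "(\<Prod>i<n. 1 - z * lam i) = (\<Sum>k\<le>n. (- z) ^ k * of_real (minor_sum n (\<lambda>i j. a (i, j)) k))" for z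
    unfolding lam(1)[symmetric] A_def of_real_minor_sum[symmetric] by (rule det_one_minus_smult)
  have trace: "(\<Sum>i<n. lam i ^ Suc k) = of_real (closed_walk_sum n a (Suc k))" for k
  proof -
    have "(\<Sum>i<n. lam i ^ Suc k) = (\<Sum>xs\<in>words n (Suc k). prod_list (map (($$) A) (cyc_edges xs)))"
      unfolding lam(2)[symmetric] by (rule trace_pow_closed_walks[OF A])
    also have "\<dots> = closed_walk_sum n (\<lambda>e. complex_of_real (a e)) (Suc k)"
      unfolding closed_walk_sum_def
    proof (intro sum.cong refl arg_cong[of _ _ prod_list] map_cong)
      fix xs e assume "xs \<in> words n (Suc k)" "e \<in> set (cyc_edges xs)"
      then have "e \<in> {..<n} \<times> {..<n}" using set_cyc_edges_subset[of xs] by (auto simp: words_def)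
      then show "A $$ e = complex_of_real (a e)" by (auto simp: A_def)
    qed
    finally show ?thesis by (simp only: of_real_closed_walk_sum)
  qed
  have "spectral_radius A \<in> norm ` spectrum A" by (rule spectral_radius_mem_max(1)[OF A n])
  then obtain i where i: "i < n" "norm (lam i) = spectral_radius A" using lam(3) by auto
  then have ge: "norm (lam i) \<ge> 1 / r" using big by (simp add: real_spectral_radius_def map)
  then have pos: "norm (lam i) > 0" using r by (smt (verit) divide_pos_pos)
  then have nz: "lam i \<noteq> 0" by auto
  define z0 where "z0 = 1 / lam i"
  have "norm z0 \<le> r" using ge pos r by (simp add: z0_def norm_divide field_simps)
  moreover have "(\<Prod>i<n. 1 - z0 * lam i) = 0" using i(1) nz by (intro prod_zero bexI[of _ i]) (auto simp: z0_def)
  moreover have "(\<Sum>k\<le>n. norm (complex_of_real (minor_sum n (\<lambda>i j. a (i, j)) k)) * R ^ k) \<le> L"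
    using Le by (simp only: norm_of_real)
  moreover have "(\<Sum>k<K. norm (\<Sum>i<n. lam i ^ Suc k) * R ^ Suc k / real (Suc k)) \<le> L"
    using LT by (simp only: trace norm_of_real)
  ultimately have "1 \<le> r * (L * exp L / (R - s)) * (r / s) ^ K"
    using r by (intro zero_free_disc_of_newton_exp[OF coeffs]) auto
  then show False using small by simp
qed

lemma (in symmetric_array) expectation_abs_minor_sum:
  shows "integrable N (\<lambda>x. minor_sum n (\<lambda>i j. row_normalized n x (i, j)) k)"
    and "expectation (\<lambda>x. \<bar>minor_sum n (\<lambda>i j. row_normalized n x (i, j)) k\<bar>) \<le> 1"
proof -
  let ?m = "\<lambda>x. minor_sum n (\<lambda>i j. row_normalized n x (i, j)) k"
  define \<Omega> where "\<Omega> = (SIGMA I:{I. I \<subseteq> {..<n} \<and> card I = k}. {\<sigma>. \<sigma> permutes I})"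
  have "\<bar>?m x\<bar> \<le> (\<Sum>p\<in>\<Omega>. 1)" for x
    unfolding minor_sum_def \<Omega>_def[symmetric]
  proof (rule order_trans[OF sum_abs sum_mono])
    fix p assume p: "p \<in> \<Omega>"
    have "snd p i < n" if "i \<in> fst p" for i
      using p that permutes_in_image[of "snd p" "fst p" i] by (auto simp: \<Omega>_def)
    then show "\<bar>case p of (I, \<sigma>) \<Rightarrow> of_int (sign \<sigma>) * (\<Prod>i\<in>I. row_normalized n x (i, \<sigma> i))\<bar> \<le> 1"
      using abs_prod_row_normalized_le_1[of "fst p" "snd p" n x]
      by (simp add: case_prod_unfold abs_mult sign_def)
  qed
  then have b: "\<bar>?m x\<bar> \<le> real (card \<Omega>)" for x by simp
  show int: "integrable N ?m"
    by (rule integrable_bounded[OF _ b]) measurable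
  have int2: "integrable N (\<lambda>x. (?m x)\<^sup>2)"
  proof (rule integrable_bounded)
    show "\<bar>(?m x)\<^sup>2\<bar> \<le> (real (card \<Omega>))\<^sup>2" for x
      using power_mono[OF b, of x 2] by simp
  qed measurable
  have "expectation (\<lambda>x. \<bar>?m x\<bar>) \<le> expectation (\<lambda>x. (1 + (?m x)\<^sup>2) / 2)"
  proof (rule integral_mono)
    show "\<bar>?m x\<bar> \<le> (1 + (?m x)\<^sup>2) / 2" for x
      using zero_le_power2[of "\<bar>?m x\<bar> - 1"] by (simp add: power2_diff)
  qed (use int int2 in auto)
  also have "\<dots> = (1 + expectation (\<lambda>x. (?m x)\<^sup>2)) / 2"
    using int2 prob_space by simp
  also have "\<dots> \<le> 1" using expectation_minor_sum_square[of n k] by simp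
  finally show "expectation (\<lambda>x. \<bar>?m x\<bar>) \<le> 1" .
qed

lemma (in symmetric_array) markov_bound:
  assumes "integrable N F" "\<And>x. 0 \<le> F x" "expectation F \<le> c" "0 < (L :: real)"
  shows "prob {x. L < F x} \<le> c / L"
proof -
  have [measurable]: "F \<in> borel_measurable N" using assms(1) by auto
  have "{x \<in> space N. L \<le> F x} \<in> sets N" by measurable
  then have "prob {x. L < F x} \<le> prob {x \<in> space N. L \<le> F x}"
    by (intro finite_measure_mono) auto
  also have "\<dots> \<le> expectation F / L"
    by (rule integral_Markov_inequality_measure[where A = "{}"]) (use assms in auto)
  also have "\<dots> \<le> c / L" using assms by (intro divide_right_mono) auto
  finally show ?thesis .
qed

lemma sum_power_le_inverse:
  assumes "0 \<le> R" "R < (1 :: real)"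
  shows "(\<Sum>k<n. R ^ k) \<le> 1 / (1 - R)"
proof -
  have "(\<Sum>k<n. R ^ k) \<le> (\<Sum>k. R ^ k)"
    using assms by (intro sum_le_suminf summable_geometric) auto
  then show ?thesis using suminf_geometric[of R] assms by simp
qed

text \<open>The threshold for \<open>n\<close> makes the \<open>K\<close> error terms of the traces
  add up to at most 1, so that the bound contains no \<open>K\<close>; this permits choosing
  \<open>K\<close> after \<open>L\<close>. The constant 4 is 1 from the coefficients plus 3 from the
  traces.\<close>

lemma (in symmetric_array) prob_exceptional_le:
  assumes R: "0 < R" "R < 1" and L: "L > 0" and n: "n \<ge> 2 + K * fact (2 * K)"
  shows "prob {x. L < (\<Sum>k\<le>n. \<bar>minor_sum n (\<lambda>i j. row_normalized n x (i, j)) k\<bar> * R ^ k) \<or>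
      L < (\<Sum>k<K. \<bar>closed_walk_sum n (row_normalized n x) (Suc k)\<bar> * R ^ Suc k / real (Suc k))}
    \<le> 4 / (1 - R) / L"
proof -
  let ?F = "\<lambda>x. \<Sum>k\<le>n. \<bar>minor_sum n (\<lambda>i j. row_normalized n x (i, j)) k\<bar> * R ^ k"
  let ?G = "\<lambda>x. \<Sum>k<K. \<bar>closed_walk_sum n (row_normalized n x) (Suc k)\<bar> * R ^ Suc k / real (Suc k)"
  have intF: "integrable N ?F"
    by (intro Bochner_Integration.integrable_sum integrable_mult_left integrable_abs expectation_abs_minor_sum)
  have intG: "integrable N ?G"
    by (intro Bochner_Integration.integrable_sum integrable_divide integrable_mult_left integrable_abs
        integrable_closed_walk_sum)
  have geo: "(\<Sum>k<m. R ^ k) \<le> 1 / (1 - R)" for m using sum_power_le_inverse R by simp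
  have "expectation ?F = (\<Sum>k\<le>n. expectation (\<lambda>x. \<bar>minor_sum n (\<lambda>i j. row_normalized n x (i, j)) k\<bar>) * R ^ k)"
    by (subst Bochner_Integration.integral_sum) (auto intro!: integrable_mult_left integrable_abs expectation_abs_minor_sum)
  also have "\<dots> \<le> (\<Sum>k\<le>n. 1 * R ^ k)"
    using R by (intro sum_mono mult_right_mono expectation_abs_minor_sum) auto
  also have "\<dots> \<le> 1 / (1 - R)" using geo[of "Suc n"] by (simp add: lessThan_Suc_atMost)
  finally have EF: "expectation ?F \<le> 1 / (1 - R)" .
  have "expectation ?G = (\<Sum>k<K. expectation (\<lambda>x. \<bar>closed_walk_sum n (row_normalized n x) (Suc k)\<bar>) * R ^ Suc k / real (Suc k))"
    by (subst Bochner_Integration.integral_sum)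
       (auto intro!: integrable_divide integrable_mult_left integrable_abs integrable_closed_walk_sum
         simp del: power_Suc of_nat_Suc)
  also have "\<dots> \<le> (\<Sum>k<K. 2 * R ^ k + fact (2 * K) / real (n - 1))"
  proof (rule sum_mono)
    fix k assume k: "k \<in> {..<K}"
    let ?c = "fact (2 * K) / real (n - 1)"
    have "expectation (\<lambda>x. \<bar>closed_walk_sum n (row_normalized n x) (Suc k)\<bar>) \<le>
        2 * real (Suc k) + fact (2 * Suc k) / real (n - 1)"
      using n by (intro expectation_abs_closed_walk_sum) auto
    also have "\<dots> \<le> 2 * real (Suc k) + ?c"
      using k by (intro add_left_mono divide_right_mono fact_mono) auto
    finally have "expectation (\<lambda>x. \<bar>closed_walk_sum n (row_normalized n x) (Suc k)\<bar>) * R ^ Suc k / real (Suc k)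
       \<le> (2 * real (Suc k) + ?c) * R ^ Suc k / real (Suc k)"
      using R by (intro divide_right_mono mult_right_mono) auto
    \<comment> \<open>Here the linear growth of the trace bound cancels against the denominator,
      leaving a geometric series.\<close>
    also have "\<dots> = 2 * R ^ Suc k + ?c * (R ^ Suc k / real (Suc k))"
      by (simp add: field_simps del: of_nat_Suc power_Suc)
    also have "\<dots> \<le> 2 * R ^ k + ?c * 1"
    proof (intro add_mono mult_left_mono)
      show "R ^ Suc k \<le> R ^ k" using R by (intro power_decreasing) auto
      have "R ^ Suc k \<le> 1" using R by (intro power_le_one) auto
      then show "R ^ Suc k / real (Suc k) \<le> 1"
        by (simp add: divide_le_eq del: power_Suc)
    qed auto
    finally show "expectation (\<lambda>x. \<bar>closed_walk_sum n (row_normalized n x) (Suc k)\<bar>) * R ^ Suc k / real (Suc k)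
       \<le> 2 * R ^ k + ?c" by simp
  qed
  also have "\<dots> = 2 * (\<Sum>k<K. R ^ k) + real (K * fact (2 * K)) / real (n - 1)"
    by (simp add: sum.distrib sum_distrib_left)
  also have "\<dots> \<le> 2 * (1 / (1 - R)) + 1"
  proof (intro add_mono mult_left_mono geo)
    have "real (K * fact (2 * K)) \<le> real (n - 1)" using n by (intro of_nat_mono) linarith
    then show "real (K * fact (2 * K)) / real (n - 1) \<le> 1"
      using n by (subst pos_divide_le_eq) auto
  qed auto
  \<comment> \<open>The remaining 1 is absorbed through \<open>1 \<le> 1 / (1 - R)\<close>.\<close>
  also have "\<dots> \<le> 3 / (1 - R)" using R by (simp add: field_simps)
  finally have EG: "expectation ?G \<le> 3 / (1 - R)" .
  have "{x. L < ?F x \<or> L < ?G x} = {x. L < ?F x} \<union> {x. L < ?G x}" by auto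
  moreover have "{x. L < ?F x} \<in> events" "{x. L < ?G x} \<in> events"
    using borel_measurable_less[OF borel_measurable_const borel_measurable_integrable[OF intF]]
      borel_measurable_less[OF borel_measurable_const borel_measurable_integrable[OF intG]] by auto
  ultimately have "prob {x. L < ?F x \<or> L < ?G x} \<le> prob {x. L < ?F x} + prob {x. L < ?G x}"
    by (simp add: measure_Un_le)
  also have "\<dots> \<le> 1 / (1 - R) / L + 3 / (1 - R) / L"
    using R L by (intro add_mono markov_bound intF intG EF EG sum_nonneg) auto
  also have "\<dots> = 4 / (1 - R) / L" by (simp add: add_divide_distrib[symmetric])
  finally show ?thesis .
qed

section \<open>Transfer to i.i.d. arrays and conclusion\<close>

lemma (in prob_space) distr_iid:
  assumes "indep_vars (\<lambda>_. borel) Z UNIV" "\<And>e. distr M borel (Z e) = \<mu>"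
  shows "distr M (Pi\<^sub>M UNIV (\<lambda>_. borel)) (\<lambda>\<omega> e. Z e \<omega>) = Pi\<^sub>M UNIV (\<lambda>_. \<mu> :: real measure)"
proof -
  have "\<And>e. random_variable borel (Z e)" using assms(1) unfolding indep_vars_def by blast
  then show ?thesis
    using indep_vars_iff_distr_eq_PiM[where I = UNIV and M' = "\<lambda>_. borel" and X = Z] assms
    by (simp add: restrict_UNIV)
qed

text \<open>Changing one sign gives again an independent family with the same marginals, hence the
  same product law. A swap is a reindexing of a product of equal factors.\<close>

lemma symmetric_array_iid:
  fixes Z :: "nat \<times> nat \<Rightarrow> 'w \<Rightarrow> real"
  assumes "prob_space M" and indep: "prob_space.indep_vars M (\<lambda>_. borel) Z UNIV"
    and ident: "\<And>e. distr M borel (Z e) = \<mu>"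
    and symm: "\<And>e. distr M borel (\<lambda>\<omega>. - Z e \<omega>) = \<mu>"
  shows "symmetric_array (distr M (Pi\<^sub>M UNIV (\<lambda>_. borel)) (\<lambda>\<omega> e. Z e \<omega>))" (is "symmetric_array ?N")
proof -
  interpret prob_space M by fact
  let ?P = "Pi\<^sub>M UNIV (\<lambda>_ :: nat \<times> nat. borel :: real measure)"
  have rv [measurable]: "random_variable borel (Z e)" for e using indep unfolding indep_vars_def by blast
  have Zm [measurable]: "(\<lambda>\<omega> e. Z e \<omega>) \<in> measurable M ?P"
    by (rule measurable_PiM_single') auto
  have N: "?N = Pi\<^sub>M UNIV (\<lambda>_. \<mu>)" by (rule distr_iid[OF indep ident])
  have \<mu>: "prob_space \<mu>" using ident[of undefined] prob_space_distr[OF rv] by metis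
  show ?thesis
  proof (intro symmetric_array.intro symmetric_array_axioms.intro)
    show "prob_space ?N" by (rule prob_space_distr[OF Zm])
    show "sets ?N = sets ?P" by simp
    fix e :: "nat \<times> nat"
    have fm: "flip_at e \<in> measurable ?P ?P"
      unfolding flip_at_def by (rule measurable_PiM_single') (auto simp: space_PiM)
    have "distr ?N ?N (flip_at e) = distr ?N ?P (flip_at e)"
      by (rule distr_cong) auto
    also have "\<dots> = distr M ?P (\<lambda>\<omega> e'. (if e' = e then - Z e' \<omega> else Z e' \<omega>))"
      by (subst distr_distr[OF fm Zm]) (auto simp: flip_at_def o_def intro!: distr_cong)
    also have "\<dots> = Pi\<^sub>M UNIV (\<lambda>_. \<mu>)"
    proof (rule distr_iid)
      show "indep_vars (\<lambda>_. borel) (\<lambda>e' \<omega>. if e' = e then - Z e' \<omega> else Z e' \<omega>) UNIV"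
        using indep_vars_compose2[OF indep, of "\<lambda>e' v. if e' = e then - v else v" "\<lambda>_. borel"] by simp
      show "distr M borel (\<lambda>\<omega>. if e' = e then - Z e' \<omega> else Z e' \<omega>) = \<mu>" for e'
        using ident symm by (cases "e' = e") auto
    qed
    finally show "distr ?N ?N (flip_at e) = ?N" by (simp only: N)
    fix e' :: "nat \<times> nat"
    have "distr (Pi\<^sub>M UNIV (\<lambda>_. \<mu>)) (Pi\<^sub>M UNIV (\<lambda>_. \<mu>))
        (\<lambda>x. \<lambda>i\<in>UNIV. x (Transposition.transpose e e' i)) = Pi\<^sub>M UNIV (\<lambda>_. \<mu>)"
      by (rule distr_PiM_reindex[of UNIV "\<lambda>_. \<mu>" "Transposition.transpose e e'" UNIV])
         (auto simp: \<mu> intro: inj_on_inverseI[of _ "Transposition.transpose e e'"])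
    then show "distr ?N ?N (\<lambda>x. x \<circ> Transposition.transpose e e') = ?N"
      by (simp add: N o_def restrict_UNIV)
  qed
qed

theorem corollary2p6:
  fixes M :: "'w measure" and X :: "nat \<Rightarrow> nat \<Rightarrow> 'w \<Rightarrow> real" and \<epsilon> :: real
  assumes prob: "prob_space M"
    and indep: "prob_space.indep_vars M (\<lambda>_. borel) (\<lambda>(i, j). X i j) UNIV"
    and ident: "\<And>i j. distr M borel (X i j) = distr M borel (X 0 0)"
    and nondegenerate: "\<not> (\<exists>c. AE \<omega> in M. X 0 0 \<omega> = c)"
    and symmetric: "distr M borel (X 0 0) = distr M borel (\<lambda>\<omega>. - X 0 0 \<omega>)"
    and "\<epsilon> > 0"
  shows "(\<lambda>n. measure M {\<omega> \<in> space M.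
            real_spectral_radius (self_normalized_mat n (\<lambda>i j. X i j \<omega>)) \<ge> 1 + \<epsilon>})
         \<longlonglongrightarrow> 0"
proof (rule LIMSEQ_I)
  interpret M: prob_space M by fact
  fix \<delta> :: real assume \<delta>: "\<delta> > 0"
  define Z where "Z e = X (fst e) (snd e)" for e
  let ?P = "Pi\<^sub>M UNIV (\<lambda>_ :: nat \<times> nat. borel :: real measure)"
  define N where "N = distr M ?P (\<lambda>\<omega> e. Z e \<omega>)"
  have Zcase: "Z = (\<lambda>(i, j). X i j)" by (auto simp: Z_def fun_eq_iff)
  have rv [measurable]: "M.random_variable borel (Z e)" for e
    using indep unfolding M.indep_vars_def Zcase by blast
  have ident': "distr M borel (Z e) = distr M borel (X 0 0)" for e unfolding Z_def by (rule ident)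
  have neg: "distr M borel (\<lambda>\<omega>. - Z e \<omega>) = distr (distr M borel (Z e)) borel uminus" for e
    by (subst distr_distr) (auto simp: o_def)
  have symm: "distr M borel (\<lambda>\<omega>. - Z e \<omega>) = distr M borel (X 0 0)" for e
  proof -
    have "distr M borel (\<lambda>\<omega>. - Z e \<omega>) = distr M borel (\<lambda>\<omega>. - Z (0, 0) \<omega>)"
      by (simp only: neg ident')
    also have "\<dots> = distr M borel (X 0 0)"
      using symmetric by (simp add: Z_def)
    finally show ?thesis .
  qed
  interpret N: symmetric_array N
    unfolding N_def by (rule symmetric_array_iid[OF prob _ ident' symm]) (use indep Zcase in simp)
  \<comment> \<open>\<open>1 / r\<close> is the level \<open>1 + \<epsilon>\<close> of the theorem;
    \<open>s\<close> and \<open>R\<close> leave room for the maximum principle and for Cauchy's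
    estimate.\<close>
  define r where "r = 1 / (1 + \<epsilon>)"
  have r: "0 < r" "r < 1" using \<open>\<epsilon> > 0\<close> by (auto simp: r_def)
  obtain s where s: "r < s" "s < 1" using dense[OF r(2)] by auto
  obtain R where R: "s < R" "R < 1" using dense[OF s(2)] by auto
  have R0: "R > 0" using r s R by linarith
  \<comment> \<open>The constant 8 turns the exceptional probability \<open>4 / (1 - R) / L\<close>
    into \<open>\<delta> / 2\<close>.\<close>
  define L where "L = 8 / (1 - R) / \<delta>"
  have L: "L > 0" using R \<delta> by (simp add: L_def)
  have "(\<lambda>K. r * (L * exp L / (R - s)) * (r / s) ^ K) \<longlonglongrightarrow> r * (L * exp L / (R - s)) * 0"
    using r s by (intro tendsto_mult_left LIMSEQ_power_zero) auto
  then have "eventually (\<lambda>K. r * (L * exp L / (R - s)) * (r / s) ^ K < 1) sequentially"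
    by (intro order_tendstoD(2)[where y = "r * (L * exp L / (R - s)) * 0"]) auto
  then obtain K where K: "r * (L * exp L / (R - s)) * (r / s) ^ K < 1"
    by (auto simp: eventually_sequentially)
  show "\<exists>n0. \<forall>n\<ge>n0. norm (measure M {\<omega> \<in> space M.
      real_spectral_radius (self_normalized_mat n (\<lambda>i j. X i j \<omega>)) \<ge> 1 + \<epsilon>} - 0) < \<delta>"
  proof (intro exI[of _ "2 + K * fact (2 * K)"] allI impI)
    fix n assume n: "n \<ge> 2 + K * fact (2 * K)"
    let ?E = "{\<omega> \<in> space M. real_spectral_radius (self_normalized_mat n (\<lambda>i j. X i j \<omega>)) \<ge> 1 + \<epsilon>}"
    let ?B = "{x. L < (\<Sum>k\<le>n. \<bar>minor_sum n (\<lambda>i j. row_normalized n x (i, j)) k\<bar> * R ^ k) \<or>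
      L < (\<Sum>k<K. \<bar>closed_walk_sum n (row_normalized n x) (Suc k)\<bar> * R ^ Suc k / real (Suc k))}"
    have "{x \<in> space N. L < (\<Sum>k\<le>n. \<bar>minor_sum n (\<lambda>i j. row_normalized n x (i, j)) k\<bar> * R ^ k) \<or>
      L < (\<Sum>k<K. \<bar>closed_walk_sum n (row_normalized n x) (Suc k)\<bar> * R ^ Suc k / real (Suc k))} \<in> sets N"
      by measurable
    then have B: "?B \<in> sets ?P" by (simp only: N.space_N UNIV_I simp_thms N.sets_N)
    have Zm: "(\<lambda>\<omega> e. Z e \<omega>) \<in> measurable M ?P"
      by (rule measurable_PiM_single') auto
    \<comment> \<open>Monotonicity of the measure asks for measurability of the larger event only,
      so the spectral radius need not be shown to be a measurable function.\<close>
    have "?E \<subseteq> (\<lambda>\<omega> e. Z e \<omega>) -` ?B \<inter> space M"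
    proof
      fix \<omega> assume \<omega>: "\<omega> \<in> ?E"
      let ?x = "\<lambda>e. Z e \<omega>"
      have mat: "self_normalized_mat n (\<lambda>i j. X i j \<omega>) = Matrix.mat n n (row_normalized n ?x)"
        by (rule eq_matI) (auto simp: self_normalized_mat_def row_normalized_def Z_def)
      have "?x \<in> ?B"
      proof (rule ccontr)
        assume "?x \<notin> ?B"
        then have "real_spectral_radius (Matrix.mat n n (row_normalized n ?x)) < 1 / r"
          using n r s R K by (intro real_spectral_radius_less[of n r s R _ L K]) auto
        then show False using \<omega> r \<open>\<epsilon> > 0\<close> by (simp add: mat r_def)
      qed
      then show "\<omega> \<in> (\<lambda>\<omega> e. Z e \<omega>) -` ?B \<inter> space M" using \<omega> by simp
    qed
    moreover have "(\<lambda>\<omega> e. Z e \<omega>) -` ?B \<inter> space M \<in> sets M"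
      by (rule measurable_sets[OF Zm B])
    ultimately have "measure M ?E \<le> measure M ((\<lambda>\<omega> e. Z e \<omega>) -` ?B \<inter> space M)"
      by (rule M.finite_measure_mono)
    also have "\<dots> = measure N ?B"
      unfolding N_def by (rule measure_distr[OF Zm B, symmetric])
    also have "\<dots> \<le> 4 / (1 - R) / L"
      by (rule N.prob_exceptional_le[OF R0 R(2) L n])
    also have "\<dots> = \<delta> / 2" using R \<delta> by (simp add: L_def field_simps)
    finally show "norm (measure M ?E - 0) < \<delta>" using \<delta> by simp
  qed
qed

end
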